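(* For every $-\frac12<\theta<\frac12$ there is a Dirichlet series $g_\theta\in\mathscr{H}^2$ with \[\sigma_{\mathrm{c}}(g_\theta)=\theta,\qquad \sigma_{\mathrm{a}}(g_\theta)=\frac12,\qquad \mu_{g_\theta}(\sigma)=\frac{1-2\sigma}{1-2\theta}\ \text{ for } \theta<\sigma\leq\frac12,\qquad\text{and}\qquad \sigma_{\mathrm{m}}(g_\theta)=\frac{1+2\theta}{4}.\] In particular (taking $-\frac12<\theta\leq0$), it is not true that every $f\in\mathscr{H}^2$ with $\sigma_{\mathrm{c}}(f)\leq0$ satisfies $\sigma_{\mathrm{m}}(f)\leq0$.
   Context: Write $s=\sigma+it$ and, for real $\kappa$, $\mathbb{C}_\kappa=\{s=\sigma+it : \sigma>\kappa\}$. $\mathscr{H}^2$ is the Hilbert space of Dirichlet series $f(s)=\sum_{n\geq1}a_n n^{-s}$ with complex coefficients and $\|f\|_{\mathscr{H}^2}^2=\sum_{n\geq1}|a_n|^2<\infty$; such a series converges absolutely and is analytic in $\mathbb{C}_{1/2}$. $\sigma_{\mathrm{c}}(f)$ and $\sigma_{\mathrm{a}}(f)$ denote the abscissa of convergence and the abscissa of absolute convergence of the Dirichlet series $f$. An analytic continuation of a somewhere convergent Dirichlet series $f$ to $\mathbb{C}_\kappa$ is an analytic function on $\mathbb{C}_\kappa$ that agrees with the sum of the series wherever the series converges in $\mathbb{C}_\kappa$; it is again denoted $f$. An analytic function $f$ on $\mathbb{C}_\kappa$ is of finite order in $\mathbb{C}_\kappa$ if for every $\varepsilon>0$ there are constants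 $A,B$ such that $|f(\sigma+it)|\leq B(1+|t|)^A$ for all $\sigma\geq\kappa+\varepsilon$ and all real $t$. For such $f$ the Lindelöf order function is \[\mu_f(\sigma)=\limsup_{|t|\to\infty}\frac{\log|f(\sigma+it)|}{\log|t|},\qquad \sigma>\kappa.\] For a somewhere convergent Dirichlet series $f(s)=\sum_{n\geq1}a_n n^{-s}$, $\sigma_{\mathrm{m}}(f)$ denotes the infimum of those real $\kappa$ such that $f$ has an analytic continuation of finite order to $\mathbb{C}_\kappa$ and such that for every $\sigma>\kappa$ the mean value formula \[\lim_{T\to\infty}\frac{1}{2T}\int_{-T}^T|f(\sigma+it)|^2\,dt=\sum_{n=1}^\infty|a_n|^2n^{-2\sigma}\] holds, in the sense that both sides are finite and equal. *)

theory Defs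
  imports "HOL-Complex_Analysis.Complex_Analysis"
begin

text \<open>
  A Dirichlet series is represented by its coefficient sequence \<open>a :: nat \<Rightarrow> complex\<close>, where
  \<open>a n\<close> is the coefficient of \<open>n\<close> to the power \<open>-s\<close>. The value \<open>a 0\<close> is irrelevant: all series
  are indexed by \<open>k = n - 1\<close>.
\<close>

definition right_half_plane :: "real \<Rightarrow> complex set" where
  "right_half_plane \<kappa> = {s. Re s > \<kappa>}"

definition dirichlet_term :: "(nat \<Rightarrow> complex) \<Rightarrow> complex \<Rightarrow> nat \<Rightarrow> complex" where
  "dirichlet_term a s k = a (Suc k) * of_nat (Suc k) powr (- s)"

definition dirichlet_sum :: "(nat \<Rightarrow> complex) \<Rightarrow> complex \<Rightarrow> complex" where
  "dirichlet_sum a s = (\<Sum>k. dirichlet_term a s k)"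

definition hardy_H2 :: "(nat \<Rightarrow> complex) set" where
  "hardy_H2 = {a. summable (\<lambda>k. (cmod (a (Suc k)))\<^sup>2)}"

definition abscissa_conv :: "(nat \<Rightarrow> complex) \<Rightarrow> ereal" where
  "abscissa_conv a =
     Inf {ereal \<kappa> | \<kappa>. \<forall>s \<in> right_half_plane \<kappa>. summable (dirichlet_term a s)}"

definition abscissa_abs_conv :: "(nat \<Rightarrow> complex) \<Rightarrow> ereal" where
  "abscissa_abs_conv a =
     Inf {ereal \<kappa> | \<kappa>. \<forall>s \<in> right_half_plane \<kappa>. summable (\<lambda>k. norm (dirichlet_term a s k))}"

text \<open>
  Meaningful only for a somewhere convergent series; otherwise the agreement condition is vacuous.
\<close>

definition is_analytic_continuation ::
    "(nat \<Rightarrow> complex) \<Rightarrow> real \<Rightarrow> (complex \<Rightarrow> complex) \<Rightarrow> bool" where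
  "is_analytic_continuation a \<kappa> F \<longleftrightarrow>
     F holomorphic_on right_half_plane \<kappa> \<and>
     (\<forall>s \<in> right_half_plane \<kappa>. summable (dirichlet_term a s) \<longrightarrow> F s = dirichlet_sum a s)"

definition finite_order :: "real \<Rightarrow> (complex \<Rightarrow> complex) \<Rightarrow> bool" where
  "finite_order \<kappa> F \<longleftrightarrow>
     F holomorphic_on right_half_plane \<kappa> \<and>
     (\<forall>\<epsilon>>0. \<exists>A B :: real. \<forall>\<sigma> \<ge> \<kappa> + \<epsilon>. \<forall>t.
        cmod (F (Complex \<sigma> t)) \<le> B * (1 + \<bar>t\<bar>) powr A)"

text \<open>The logarithm with \<open>log 0 = -\<infinity>\<close>; the library's \<open>ln 0\<close> is \<open>0\<close>.\<close>

definition log_ext :: "real \<Rightarrow> ereal" where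
  "log_ext x = (if x = 0 then -\<infinity> else ereal (ln x))"

definition lindelof_order :: "(complex \<Rightarrow> complex) \<Rightarrow> real \<Rightarrow> ereal" where
  "lindelof_order F \<sigma> =
     Limsup at_infinity (\<lambda>t::real. log_ext (cmod (F (Complex \<sigma> t))) / ereal (ln \<bar>t\<bar>))"

text \<open>
  The series on the right-hand side is required to be summable, and the limit to be a real number,
  so that both sides are finite.
\<close>

definition mean_value_formula ::
    "(nat \<Rightarrow> complex) \<Rightarrow> (complex \<Rightarrow> complex) \<Rightarrow> real \<Rightarrow> bool" where
  "mean_value_formula a F \<sigma> \<longleftrightarrow>
     summable (\<lambda>k. (cmod (a (Suc k)))\<^sup>2 * real (Suc k) powr (- 2 * \<sigma>)) \<and>
     ((\<lambda>T::real. 1 / (2 * T) * integral {-T..T} (\<lambda>t. (cmod (F (Complex \<sigma> t)))\<^sup>2))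
        \<longlongrightarrow> (\<Sum>k. (cmod (a (Suc k)))\<^sup>2 * real (Suc k) powr (- 2 * \<sigma>))) at_top"

definition abscissa_mean :: "(nat \<Rightarrow> complex) \<Rightarrow> ereal" where
  "abscissa_mean a =
     Inf {ereal \<kappa> | \<kappa>. \<exists>F. is_analytic_continuation a \<kappa> F \<and> finite_order \<kappa> F \<and>
            (\<forall>\<sigma>>\<kappa>. mean_value_formula a F \<sigma>)}"

end

theory Submission
  imports Defs
begin

text \<open>
  The series \<open>g\<close> is a sum of blocks. The \<open>j\<close>-th block is supported on \<open>N \<le> n < 2 N\<close> with
  \<open>N = 2 ^ 2 ^ j\<close>, where its coefficients are \<open>weight j * N powr - (1 / 2) * n powr (\<i> * \<tau>)\<close>,
  with frequency \<open>\<tau> = N powr (1 / 2 - \<theta>)\<close> and \<open>weight j = 2 powr - j\<close>. The absolute values alone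
  place \<open>g\<close> in \<open>\<H>\<^sup>2\<close> with abscissa of absolute convergence \<open>1 / 2\<close>; the twist by \<open>\<i> * \<tau>\<close> moves
  the peak of the block from the real axis to height \<open>\<tau>\<close>. On the line \<open>Re s = \<sigma>\<close> the block behaves
  as follows, up to weights, which are negligible against any positive power of \<open>N\<close>.

  \<^item> Around height \<open>\<tau>\<close> nothing cancels and the block has size \<open>N powr (1 / 2 - \<sigma>)\<close>, a power of
    \<open>\<tau>\<close> with exponent \<open>(1 - 2 * \<sigma>) / (1 - 2 * \<theta>)\<close>. This is the Lindelof order
    (\<open>block_dominates_near_freq\<close>, \<open>norm_dirichlet_sum_le_height\<close>).
  \<^item> At heights up to \<open>\<tau> / 2\<close> the Kusmin--Landau inequality shows that all partial sums are
    \<open>O(N powr (1 / 2 - \<sigma>) / \<tau>) = O(N powr (\<theta> - \<sigma>))\<close>, and on the real axis this is attained. This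
    gives convergence exactly down to \<open>\<theta>\<close>, and finite order there
    (\<open>norm_sum_powr_cis_ln_le\<close>, \<open>norm_partial_block_le_uniform\<close>, \<open>not_summable_dirichlet_term\<close>).
  \<^item> The mean square over \<open>[-T, T]\<close> is worst for \<open>T\<close> near \<open>\<tau>\<close>, when the peak has just entered, and
    is then \<open>N powr (1 - 2 * \<sigma>) / \<tau> = N powr (2 * ((1 + 2 * \<theta>) / 4 - \<sigma>))\<close>. Above the critical line
    the blocks are therefore summable in mean square uniformly in \<open>T\<close>, and the mean value formula passes
    from finite sums to \<open>g\<close> (\<open>rms_block_sum_le\<close>, \<open>tendsto_rms_suminf\<close>); below it the peaks
    make the mean square unbounded (\<open>not_tendsto_mean\<close>).

  The last part of the theorem is the case \<open>\<theta> = 0\<close>, with abscissas \<open>0\<close> and \<open>1 / 4\<close>.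
\<close>

section \<open>Exponential sums with logarithmic phase\<close>

text \<open>
  Abel summation: the increments of a monotone \<open>d\<close> have constant sign, so its total variation
  collapses to a difference of two values and costs no factor depending on the length.
\<close>

lemma norm_sum_monotone_telescope_le:
  fixes U :: "nat \<Rightarrow> complex" and d :: "nat \<Rightarrow> real"
  assumes mono: "(\<forall>m n. A \<le> m \<longrightarrow> m \<le> n \<longrightarrow> n < B \<longrightarrow> d m \<le> d n) \<or>
                 (\<forall>m n. A \<le> m \<longrightarrow> m \<le> n \<longrightarrow> n < B \<longrightarrow> d n \<le> d m)"
    and d: "\<And>n. A \<le> n \<Longrightarrow> n < B \<Longrightarrow> 0 \<le> d n \<and> d n \<le> D"
    and U: "\<And>n. A \<le> n \<Longrightarrow> n \<le> B \<Longrightarrow> cmod (U n) \<le> S"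
    and "0 \<le> D" "0 \<le> S"
  shows "cmod (\<Sum>n=A..<B. of_real (d n) * (U (Suc n) - U n)) \<le> 3 * D * S"
proof (cases "A < B")
  case False
  then show ?thesis using assms by simp
next
  case True
  have id: "(\<Sum>n=A..<Suc (A + k). of_real (d n) * (U (Suc n) - U n)) =
      of_real (d (A + k)) * U (Suc (A + k)) - of_real (d A) * U A
      - (\<Sum>n=A..<A + k. of_real (d (Suc n) - d n) * U (Suc n))" for k
  proof (induction k)
    case 0
    then show ?case by (simp add: algebra_simps)
  next
    case (Suc k)
    show ?case
      using Suc.IH by (simp add: algebra_simps)
  qed
  define k where "k = B - 1 - A"
  have B: "B = Suc (A + k)" using True by (simp add: k_def)
  have tele: "(\<Sum>n=A..<A + k. d (Suc n) - d n) = d (A + k) - d A"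
    by (rule sum_Suc_diff') simp
  have var: "(\<Sum>n=A..<A + k. \<bar>d (Suc n) - d n\<bar>) \<le> D"
    using mono
  proof
    assume *: "\<forall>m n. A \<le> m \<longrightarrow> m \<le> n \<longrightarrow> n < B \<longrightarrow> d m \<le> d n"
    have "(\<Sum>n=A..<A + k. \<bar>d (Suc n) - d n\<bar>) = (\<Sum>n=A..<A + k. d (Suc n) - d n)"
      using * B by (intro sum.cong) auto
    then show ?thesis using tele d[of A] d[of "A + k"] B by simp
  next
    assume *: "\<forall>m n. A \<le> m \<longrightarrow> m \<le> n \<longrightarrow> n < B \<longrightarrow> d n \<le> d m"
    have "(\<Sum>n=A..<A + k. \<bar>d (Suc n) - d n\<bar>) = (\<Sum>n=A..<A + k. - (d (Suc n) - d n))"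
      using * B by (intro sum.cong refl abs_of_nonpos) auto
    also have "\<dots> = - (d (A + k) - d A)"
      by (simp only: sum_negf tele)
    finally show ?thesis using d[of A] d[of "A + k"] B by simp
  qed
  have "cmod (\<Sum>n=A..<A + k. of_real (d (Suc n) - d n) * U (Suc n))
      \<le> (\<Sum>n=A..<A + k. \<bar>d (Suc n) - d n\<bar> * S)"
    using U B by (intro sum_norm_le) (auto simp: norm_mult simp flip: of_real_diff intro!: mult_left_mono)
  also have "\<dots> \<le> D * S"
    using var \<open>0 \<le> S\<close> by (simp flip: sum_distrib_right add: mult_right_mono)
  finally have 3: "cmod (\<Sum>n=A..<A + k. of_real (d (Suc n) - d n) * U (Suc n)) \<le> D * S" .
  have 1: "cmod (of_real (d (A + k)) * U (Suc (A + k))) \<le> D * S"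
    using d[of "A + k"] U[of "Suc (A + k)"] B by (auto simp: norm_mult intro!: mult_mono)
  have 2: "cmod (of_real (d A) * U A) \<le> D * S"
    using d[of A] U[of A] B by (auto simp: norm_mult intro!: mult_mono)
  show ?thesis
    unfolding B id
    using norm_triangle_ineq4[of "of_real (d (A + k)) * U (Suc (A + k)) - of_real (d A) * U A"
        "\<Sum>n=A..<A + k. of_real (d (Suc n) - d n) * U (Suc n)"]
      norm_triangle_ineq4[of "of_real (d (A + k)) * U (Suc (A + k))" "of_real (d A) * U A"]
      1 2 3 by linarith
qed

text \<open>
  The Kusmin--Landau device. With \<open>\<delta> = y - x\<close>, the identity
  \<open>cis \<delta> + 1 = -\<i> cot (\<delta> / 2) (cis \<delta> - 1)\<close> turns a sum of unimodular terms into a weighted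
  telescoping sum whose weights are real, which is what allows the use of monotonicity.
\<close>

lemma cis_add_eq_cot_diff:
  assumes "sin ((y - x) / 2) \<noteq> 0"
  shows "cis y + cis x = - \<i> * of_real (cot ((y - x) / 2)) * (cis y - cis x)"
proof -
  define h m where "h = (y - x) / 2" and "m = (y + x) / 2"
  have y: "cis y = cis m * cis h" and x: "cis x = cis m * cis (- h)"
    by (simp_all add: cis_mult h_def m_def field_simps)
  have "cis h + cis (- h) = 2 * of_real (cos h)" "cis h - cis (- h) = 2 * \<i> * of_real (sin h)"
    by (auto simp: complex_eq_iff)
  then have "cis y + cis x = 2 * cis m * of_real (cos h)" "cis y - cis x = 2 * \<i> * cis m * of_real (sin h)"
    unfolding x y by (metis (no_types, opaque_lifting) distrib_left mult.assoc mult.left_commute,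
      metis (no_types, opaque_lifting) right_diff_distrib mult.assoc mult.left_commute)
  then show ?thesis
    using assms by (simp add: h_def[symmetric] cot_def field_simps)
qed

lemma le_tan:
  fixes x :: real
  assumes "0 \<le> x" "x < pi / 2"
  shows "x \<le> tan x"
proof -
  have "tan 0 - 0 \<le> tan x - x"
  proof (rule DERIV_nonneg_imp_nondecreasing[OF assms(1)])
    fix y assume y: "0 \<le> y" "y \<le> x"
    then have c: "cos y > 0" using assms by (intro cos_gt_zero_pi) auto
    have "((\<lambda>y. tan y - y) has_real_derivative inverse ((cos y)\<^sup>2) - 1) (at y)"
      using c by (auto intro!: derivative_eq_intros)
    moreover have "(cos y)\<^sup>2 \<le> 1" using abs_cos_le_one[of y] by (simp add: abs_square_le_1)
    then have "inverse ((cos y)\<^sup>2) - 1 \<ge> 0"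
      using c by (simp add: one_le_inverse_iff)
    ultimately show "\<exists>z. ((\<lambda>y. tan y - y) has_real_derivative z) (at y) \<and> 0 \<le> z" by blast
  qed
  then show ?thesis by simp
qed

lemma cot_decreasing:
  fixes x y :: real
  assumes "0 < x" "x \<le> y" "y < pi / 2"
  shows "cot y \<le> cot x"
  unfolding cot_altdef
  using assms tan_mono_le[of x y] tan_gt_zero[of x] by (intro le_imp_inverse_le) auto

lemma cot_le_inverse:
  fixes x :: real
  assumes "0 < x" "x < pi / 2"
  shows "cot x \<le> 1 / x"
  using assms le_tan[of x] by (simp add: cot_altdef inverse_eq_divide frac_le)

lemma cot_nonneg:
  fixes x :: real
  assumes "0 < x" "x < pi / 2"
  shows "0 \<le> cot x"
  using assms tan_gt_zero[of x] by (simp add: cot_altdef)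

lemma ln_Suc_diff:
  assumes "n > 0"
  shows "ln (real (Suc n)) - ln (real n) = ln (1 + 1 / real n)"
proof -
  have "1 + 1 / real n = real (Suc n) / real n" using assms by (simp add: field_simps)
  then show ?thesis using assms by (simp add: ln_div)
qed

text \<open>
  The phase increments \<open>\<phi> ln (1 + 1 / n)\<close> decrease in \<open>n\<close>, lie between
  \<open>\<phi> / (2 N)\<close> and \<open>3 / 2 < \<pi>\<close>, and hence their half-angle cotangents increase and are at most
  \<open>4 N / \<phi>\<close>. So, up to a constant, the sum is no larger than the length of the first wave, \<open>N / \<phi>\<close>, although
  it has up to \<open>N\<close> terms.
\<close>

lemma norm_sum_cis_ln_le:
  fixes \<phi> :: real
  assumes N: "0 < N" "N \<le> A" "B \<le> 2 * N" and \<phi>: "0 < \<phi>" "\<phi> \<le> 3 / 2 * real N"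
  shows "cmod (\<Sum>n=A..<B. cis (\<phi> * ln (real n))) \<le> 8 * real N / \<phi>"
proof -
  define \<delta> where "\<delta> n = \<phi> * ln (real (Suc n)) - \<phi> * ln (real n)" for n
  define u where "u n = cis (\<phi> * ln (real n))" for n
  have \<delta>: "\<delta> n = \<phi> * ln (1 + 1 / real n)" if "n > 0" for n
    unfolding \<delta>_def using ln_Suc_diff[OF that] by (simp flip: right_diff_distrib)
  have \<delta>_upper: "\<delta> n \<le> 3 / 2" if "A \<le> n" for n
  proof -
    have n: "real N \<le> real n" "0 < real n" using that N by auto
    have "\<delta> n \<le> \<phi> * (1 / real n)"
      unfolding \<delta>[of n, OF n(2)[unfolded of_nat_0_less_iff]]
      using n \<phi> by (intro mult_left_mono ln_add_one_self_le_self) auto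
    also have "\<dots> \<le> 3 / 2"
      using n \<phi> by (simp add: field_simps)
    finally show ?thesis .
  qed
  have \<delta>_lower: "\<phi> / (2 * real N) \<le> \<delta> n" if "A \<le> n" "n < B" for n
  proof -
    have n: "0 < n" "real (Suc n) \<le> 2 * real N" using that N by linarith+
    have "1 / real (Suc n) \<le> ln (1 + 1 / real n)"
      using ln_add1_ge[of "1 / real n"] n by (simp add: field_simps)
    then have "\<phi> * (1 / real (Suc n)) \<le> \<delta> n"
      unfolding \<delta>[OF n(1)] using \<phi> by (intro mult_left_mono) auto
    moreover have "\<phi> / (2 * real N) \<le> \<phi> * (1 / real (Suc n))"
      using n \<phi> N by (simp add: frac_le)
    ultimately show ?thesis by linarith
  qed
  have \<delta>_dec: "\<delta> n \<le> \<delta> m" if "A \<le> m" "m \<le> n" for m n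
    using that N \<phi> \<delta>[of m] \<delta>[of n] by (auto simp: frac_le add_pos_nonneg)
  have pos: "0 < \<delta> n" if "A \<le> n" "n < B" for n
    using \<delta>_lower[OF that] \<phi> N by (smt (verit) divide_pos_pos of_nat_0_less_iff)
  have half: "0 < \<delta> n / 2" "\<delta> n / 2 < pi / 2" if "A \<le> n" "n < B" for n
    using pos[OF that] \<delta>_upper[of n] that pi_gt3 by auto
  \<comment> \<open>Summing \<open>2 * u n = (u (Suc n) + u n) - (u (Suc n) - u n)\<close>.\<close>
  have tel: "2 * (\<Sum>n=A..<B. u n) =
     - \<i> * (\<Sum>n=A..<B. of_real (cot (\<delta> n / 2)) * (u (Suc n) - u n)) - (\<Sum>n=A..<B. u (Suc n) - u n)"
  proof -
    have "2 * u n = - \<i> * (of_real (cot (\<delta> n / 2)) * (u (Suc n) - u n)) - (u (Suc n) - u n)"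
      if "A \<le> n" "n < B" for n
    proof -
      have "sin (\<delta> n / 2) > 0" using half[OF that] by (intro sin_gt_zero) auto
      then have "u (Suc n) + u n = - \<i> * of_real (cot (\<delta> n / 2)) * (u (Suc n) - u n)"
        unfolding u_def \<delta>_def by (intro cis_add_eq_cot_diff) auto
      then show ?thesis by (simp add: algebra_simps)
    qed
    then have "(\<Sum>n=A..<B. 2 * u n) = (\<Sum>n=A..<B. - \<i> * (of_real (cot (\<delta> n / 2)) * (u (Suc n) - u n)) - (u (Suc n) - u n))"
      by (intro sum.cong) (simp_all only: atLeastLessThan_iff)
    then show ?thesis
      by (simp only: sum_distrib_left sum_subtractf)
  qed
  have u1: "cmod (u n) = 1" for n by (simp add: u_def)
  have b1: "cmod (\<Sum>n=A..<B. of_real (cot (\<delta> n / 2)) * (u (Suc n) - u n)) \<le> 3 * (4 * real N / \<phi>) * 1"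
  proof (rule norm_sum_monotone_telescope_le)
    show "(\<forall>m n. A \<le> m \<longrightarrow> m \<le> n \<longrightarrow> n < B \<longrightarrow> cot (\<delta> m / 2) \<le> cot (\<delta> n / 2)) \<or>
          (\<forall>m n. A \<le> m \<longrightarrow> m \<le> n \<longrightarrow> n < B \<longrightarrow> cot (\<delta> n / 2) \<le> cot (\<delta> m / 2))"
    proof (intro disjI1 allI impI)
      fix m n assume mn: "A \<le> m" "m \<le> n" "n < B"
      show "cot (\<delta> m / 2) \<le> cot (\<delta> n / 2)"
        using mn half[of m] half[of n] \<delta>_dec[of m n] by (intro cot_decreasing) auto
    qed
    fix n assume n: "A \<le> n" "n < B"
    have "cot (\<delta> n / 2) \<le> 1 / (\<delta> n / 2)" by (intro cot_le_inverse half n)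
    also have "\<dots> \<le> 1 / (\<phi> / (2 * real N) / 2)"
      using \<delta>_lower[OF n] pos[OF n] \<phi> N
      by (intro divide_left_mono) (auto intro!: mult_pos_pos divide_pos_pos)
    finally show "0 \<le> cot (\<delta> n / 2) \<and> cot (\<delta> n / 2) \<le> 4 * real N / \<phi>"
      using cot_nonneg[OF half[OF n]] by simp
  qed (use u1 \<phi> N in auto)
  have b2: "cmod (\<Sum>n=A..<B. u (Suc n) - u n) \<le> 2"
  proof (cases "A \<le> B")
    case True
    then show ?thesis
      using sum_Suc_diff'[of A B u] norm_triangle_ineq4[of "u B" "u A"] u1 by simp
  qed auto
  have "2 * cmod (\<Sum>n=A..<B. u n) = cmod (2 * (\<Sum>n=A..<B. u n))" by (simp add: norm_mult)
  also have "\<dots> \<le> cmod (- \<i> * (\<Sum>n=A..<B. of_real (cot (\<delta> n / 2)) * (u (Suc n) - u n)))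
      + cmod (\<Sum>n=A..<B. u (Suc n) - u n)"
    unfolding tel by (rule norm_triangle_ineq4)
  also have "\<dots> \<le> 12 * real N / \<phi> + 2"
    using b1 b2 by (simp add: norm_mult)
  also have "\<dots> \<le> 16 * real N / \<phi>"
    using \<phi> N by (simp add: field_simps)
  finally show ?thesis by (simp add: u_def)
qed

lemma powr_dyadic_le:
  fixes \<sigma> :: real
  assumes "0 < N" "N \<le> n" "n \<le> 2 * N" "- 1 \<le> \<sigma>"
  shows "real n powr - \<sigma> \<le> 2 * real N powr - \<sigma>"
proof (cases "0 \<le> \<sigma>")
  case True
  then have "real n powr - \<sigma> \<le> real N powr - \<sigma>"
    using assms by (intro powr_mono2') auto
  then show ?thesis using powr_ge_zero[of "real N" "- \<sigma>"] by linarith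
next
  case False
  then have "real n powr - \<sigma> \<le> (2 * real N) powr - \<sigma>"
    using assms by (intro powr_mono2) auto
  also have "\<dots> = 2 powr - \<sigma> * real N powr - \<sigma>"
    by (simp add: powr_mult)
  also have "\<dots> \<le> 2 powr 1 * real N powr - \<sigma>"
    using assms by (intro mult_right_mono powr_mono) auto
  finally show ?thesis by simp
qed

lemma powr_dyadic_ge:
  fixes \<sigma> :: real
  assumes "0 < N" "N \<le> n" "n \<le> 2 * N" "\<sigma> \<le> 1"
  shows "real N powr - \<sigma> / 2 \<le> real n powr - \<sigma>"
proof (cases "0 \<le> \<sigma>")
  case True
  have "real N powr - \<sigma> / 2 = 2 powr - 1 * real N powr - \<sigma>"
    by (simp add: powr_minus)
  also have "\<dots> \<le> 2 powr - \<sigma> * real N powr - \<sigma>"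
    using assms by (intro mult_right_mono powr_mono) auto
  also have "\<dots> = (2 * real N) powr - \<sigma>"
    by (simp add: powr_mult)
  also have "\<dots> \<le> real n powr - \<sigma>"
    using assms True by (intro powr_mono2') auto
  finally show ?thesis .
next
  case False
  then have "real N powr - \<sigma> \<le> real n powr - \<sigma>"
    using assms by (intro powr_mono2) auto
  then show ?thesis using powr_ge_zero[of "real N" "- \<sigma>"] by linarith
qed

lemma norm_sum_powr_cis_ln_le:
  fixes \<phi> \<sigma> :: real
  assumes N: "0 < N" "N \<le> A" "B \<le> 2 * N" and \<phi>: "0 < \<phi>" "\<phi> \<le> 3 / 2 * real N" and \<sigma>: "- 1 \<le> \<sigma>"
  shows "cmod (\<Sum>n=A..<B. of_real (real n powr - \<sigma>) * cis (\<phi> * ln (real n)))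
           \<le> 48 * real N powr (1 - \<sigma>) / \<phi>"
proof -
  define U where "U m = (\<Sum>n=A..<m. cis (\<phi> * ln (real n)))" for m
  have powr_le: "real n powr - \<sigma> \<le> 2 * real N powr - \<sigma>" if "N \<le> n" "n < 2 * N" for n
    using powr_dyadic_le[of N n \<sigma>] that N \<sigma> by simp
  have "cmod (\<Sum>n=A..<B. of_real (real n powr - \<sigma>) * (U (Suc n) - U n))
      \<le> 3 * (2 * real N powr - \<sigma>) * (8 * real N / \<phi>)"
  proof (rule norm_sum_monotone_telescope_le)
    show "(\<forall>m n. A \<le> m \<longrightarrow> m \<le> n \<longrightarrow> n < B \<longrightarrow> real m powr - \<sigma> \<le> real n powr - \<sigma>) \<or>
          (\<forall>m n. A \<le> m \<longrightarrow> m \<le> n \<longrightarrow> n < B \<longrightarrow> real n powr - \<sigma> \<le> real m powr - \<sigma>)"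
      using N by (cases "\<sigma> \<le> 0") (auto intro: powr_mono2 powr_mono2')
  next
    fix n assume "A \<le> n" "n \<le> B"
    then show "cmod (U n) \<le> 8 * real N / \<phi>"
      unfolding U_def using N by (intro norm_sum_cis_ln_le \<phi>) auto
  qed (use N \<phi> powr_le in auto)
  also have "(\<Sum>n=A..<B. of_real (real n powr - \<sigma>) * (U (Suc n) - U n)) =
      (\<Sum>n=A..<B. of_real (real n powr - \<sigma>) * cis (\<phi> * ln (real n)))"
    by (intro sum.cong) (auto simp: U_def)
  finally show ?thesis
    using N by (simp add: powr_diff powr_minus field_simps)
qed

lemma cos_ge_half:
  assumes "\<bar>x\<bar> \<le> (1 :: real)"
  shows "1 / 2 \<le> cos x"
proof -
  have "cos (pi / 3) \<le> cos \<bar>x\<bar>"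
    using assms pi_gt3 by (intro cos_monotone_0_pi_le) auto
  then show ?thesis by (simp add: cos_60)
qed

lemma of_nat_powr_eq_cis:
  assumes "n > 0"
  shows "(of_nat n :: complex) powr - s = of_real (real n powr - Re s) * cis (- Im s * ln (real n))"
proof -
  have "(of_nat n :: complex) powr - s = exp (- s * of_real (ln (real n)))"
    using assms by (simp add: powr_def Ln_of_nat)
  also have "\<dots> = of_real (exp (- Re s * ln (real n))) * cis (- Im s * ln (real n))"
    by (subst exp_eq_polar) simp
  finally show ?thesis using assms by (simp add: powr_def)
qed

section \<open>Mean squares over symmetric segments\<close>

lemma has_integral_cis_linear:
  fixes l T :: real
  assumes "l \<noteq> 0" "0 \<le> T"
  shows "((\<lambda>t. cis (t * l)) has_integral (cis (T * l) - cis (- T * l)) / (\<i> * of_real l)) {-T..T}"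
proof -
  have "((\<lambda>t. cis (t * l)) has_integral
      cis (T * l) / (\<i> * of_real l) - cis (- T * l) / (\<i> * of_real l)) {-T..T}"
  proof (rule fundamental_theorem_of_calculus)
    fix t :: real
    have "((\<lambda>z. exp (\<i> * (z * of_real l)) / (\<i> * of_real l)) has_field_derivative exp (\<i> * (of_real t * of_real l)))
        (at (of_real t))"
      using assms by (auto intro!: derivative_eq_intros simp: mult_ac)
    from has_vector_derivative_real_field[OF this]
    show "((\<lambda>t. cis (t * l) / (\<i> * of_real l)) has_vector_derivative cis (t * l)) (at t within {-T..T})"
      by (simp add: cis_conv_exp)
  qed (use assms in auto)
  then show ?thesis by (simp add: diff_divide_distrib)
qed

text \<open>
  Expanding the square, the diagonal gives the main term and each off-diagonal pair oscillates
  with frequency \<open>l m - l n\<close>. The bound is used in two ways: the right-hand side does not depend on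
  \<open>T\<close>, which yields the mean value formula for finite sums, and for the frequencies \<open>ln n\<close> it is
  explicit enough to be uniform in the length of the sum.
\<close>

lemma mean_square_dirichlet_polynomial:
  fixes c :: "nat \<Rightarrow> complex" and l :: "nat \<Rightarrow> real"
  assumes A: "finite A" "inj_on l A" and T: "0 \<le> T"
  shows "\<bar>integral {-T..T} (\<lambda>t. (cmod (\<Sum>n\<in>A. c n * cis (- t * l n)))\<^sup>2) - 2 * T * (\<Sum>n\<in>A. (cmod (c n))\<^sup>2)\<bar>
       \<le> (\<Sum>m\<in>A. \<Sum>n\<in>A - {m}. 2 * cmod (c m) * cmod (c n) / \<bar>l m - l n\<bar>)"
proof -
  define I where "I m n = integral {-T..T} (\<lambda>t. cis (t * (l n - l m)))" for m n
  have I: "((\<lambda>t. cis (t * (l n - l m))) has_integral I m n) {-T..T}" for m n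
    unfolding I_def by (intro integrable_integral integrable_continuous_real continuous_intros)
  have I_diag: "I m m = of_real (2 * T)" for m
    using T by (simp add: I_def scaleR_conv_of_real)
  have I_off: "cmod (I m n) \<le> 2 / \<bar>l m - l n\<bar>" if "m \<in> A" "n \<in> A - {m}" for m n
  proof -
    have "l n - l m \<noteq> 0" using that A by (auto dest: inj_onD)
    from has_integral_cis_linear[OF this T] I[of n m]
    have "I m n = (cis (T * (l n - l m)) - cis (- T * (l n - l m))) / (\<i> * of_real (l n - l m))"
      by (metis I_def integral_unique)
    moreover have "cmod (cis (T * (l n - l m)) - cis (- T * (l n - l m))) \<le> 2"
      using norm_triangle_ineq4[of "cis (T * (l n - l m))" "cis (- T * (l n - l m))"] by simp
    ultimately show ?thesis
      by (simp add: norm_divide norm_mult abs_minus_commute divide_right_mono flip: of_real_diff)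
  qed
  define Z where "Z = (\<Sum>m\<in>A. \<Sum>n\<in>A. c m * cnj (c n) * I m n)"
  define D where "D = 2 * T * (\<Sum>n\<in>A. (cmod (c n))\<^sup>2)"
  have expand: "complex_of_real ((cmod (\<Sum>n\<in>A. c n * cis (- t * l n)))\<^sup>2)
      = (\<Sum>m\<in>A. \<Sum>n\<in>A. c m * cnj (c n) * cis (t * (l n - l m)))" for t
  proof -
    have "complex_of_real ((cmod (\<Sum>n\<in>A. c n * cis (- t * l n)))\<^sup>2)
        = (\<Sum>m\<in>A. c m * cis (- t * l m)) * (\<Sum>n\<in>A. cnj (c n) * cis (t * l n))"
      unfolding complex_norm_square by (simp add: cis_cnj)
    also have "\<dots> = (\<Sum>m\<in>A. \<Sum>n\<in>A. c m * cis (- t * l m) * (cnj (c n) * cis (t * l n)))"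
      by (rule sum_product)
    also have "\<dots> = (\<Sum>m\<in>A. \<Sum>n\<in>A. c m * cnj (c n) * cis (t * (l n - l m)))"
    proof (intro sum.cong refl)
      fix m n
      have "cis (- t * l m) * cis (t * l n) = cis (t * (l n - l m))"
        by (simp add: cis_mult algebra_simps)
      then show "c m * cis (- t * l m) * (cnj (c n) * cis (t * l n)) = c m * cnj (c n) * cis (t * (l n - l m))"
        by (metis (no_types, opaque_lifting) mult.assoc mult.left_commute)
    qed
    finally show ?thesis .
  qed
  have "((\<lambda>t. \<Sum>m\<in>A. \<Sum>n\<in>A. c m * cnj (c n) * cis (t * (l n - l m))) has_integral Z) {-T..T}"
    unfolding Z_def using A by (intro has_integral_sum has_integral_mult_right I)
  then have "((\<lambda>t. complex_of_real ((cmod (\<Sum>n\<in>A. c n * cis (- t * l n)))\<^sup>2)) has_integral Z) {-T..T}"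
    by (simp only: expand)
  from has_integral_linear[OF this bounded_linear_Re]
  have int: "integral {-T..T} (\<lambda>t. (cmod (\<Sum>n\<in>A. c n * cis (- t * l n)))\<^sup>2) = Re Z"
    by (intro integral_unique) (simp add: o_def)
  have "Z = (\<Sum>m\<in>A. c m * cnj (c m) * I m m + (\<Sum>n\<in>A - {m}. c m * cnj (c n) * I m n))"
    unfolding Z_def using A by (intro sum.cong refl sum.remove) auto
  also have "\<dots> = of_real D + (\<Sum>m\<in>A. \<Sum>n\<in>A - {m}. c m * cnj (c n) * I m n)"
    by (simp add: sum.distrib I_diag D_def sum_distrib_left sum_distrib_right mult_ac flip: complex_norm_square)
  finally have Z: "Z - of_real D = (\<Sum>m\<in>A. \<Sum>n\<in>A - {m}. c m * cnj (c n) * I m n)" by simp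
  have "\<bar>Re Z - D\<bar> \<le> cmod (Z - of_real D)"
    using abs_Re_le_cmod[of "Z - of_real D"] by simp
  also have "\<dots> \<le> (\<Sum>m\<in>A. \<Sum>n\<in>A - {m}. 2 * cmod (c m) * cmod (c n) / \<bar>l m - l n\<bar>)"
    unfolding Z
  proof (intro sum_norm_le)
    fix m n assume "m \<in> A" "n \<in> A - {m}"
    from mult_left_mono[OF I_off[OF this], of "cmod (c m) * cmod (c n)"]
    show "cmod (c m * cnj (c n) * I m n) \<le> 2 * cmod (c m) * cmod (c n) / \<bar>l m - l n\<bar>"
      by (simp add: norm_mult mult_ac)
  qed
  finally show ?thesis unfolding int D_def .
qed

lemma inverse_ln_diff_le:
  assumes "0 < N" "N \<le> m" "N \<le> n" "m \<le> 2 * N" "n \<le> 2 * N" "m \<noteq> n"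
  shows "1 / \<bar>ln (real m) - ln (real n)\<bar> \<le> 2 * real N / \<bar>real m - real n\<bar>"
proof -
  have *: "1 / \<bar>ln (real m) - ln (real n)\<bar> \<le> 2 * real N / \<bar>real m - real n\<bar>"
    if "N \<le> m" "m < n" "n \<le> 2 * N" for m n
  proof -
    have mn: "0 < real m" "0 < real n" "real m < real n" "real n \<le> 2 * real N"
      using that \<open>0 < N\<close> by auto
    have "ln (real m / real n) \<le> real m / real n - 1"
      using mn by (intro ln_le_minus_one) auto
    then have "(real n - real m) / real n \<le> ln (real n) - ln (real m)"
      using mn by (simp add: ln_div diff_divide_distrib)
    moreover have "(real n - real m) / (2 * real N) \<le> (real n - real m) / real n"
      using mn by (intro divide_left_mono) auto
    ultimately have "(real n - real m) / (2 * real N) \<le> ln (real n) - ln (real m)" by linarith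
    moreover have "0 < (real n - real m) / (2 * real N)" using mn by simp
    ultimately have "1 / (ln (real n) - ln (real m)) \<le> 1 / ((real n - real m) / (2 * real N))"
      by (intro divide_left_mono mult_pos_pos) (auto simp del: zero_less_divide_iff)
    then show ?thesis using mn by simp
  qed
  show ?thesis
    using *[of m n] *[of n m] assms by (cases "m < n") (auto simp: abs_minus_commute)
qed

text \<open>
  The logarithmic loss of this harmonic sum replaces the sharp Hilbert inequality of Montgomery
  and Vaughan; the weights of the blocks absorb it.
\<close>

lemma sum_inverse_distance_le:
  assumes "m \<in> {N..<2 * N}"
  shows "(\<Sum>n\<in>{N..<2 * N} - {m}. 1 / \<bar>real m - real n\<bar>) \<le> 2 * harm N"
proof -
  have split: "{N..<2 * N} - {m} = {N..<m} \<union> {Suc m..<2 * N}" using assms by auto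
  have "(\<Sum>n=N..<m. 1 / \<bar>real m - real n\<bar>) = (\<Sum>d=1..m - N. inverse (real d))"
    by (rule sum.reindex_bij_witness[of _ "\<lambda>d. m - d" "\<lambda>n. m - n"])
       (auto simp: of_nat_diff inverse_eq_divide)
  also have "\<dots> \<le> harm N"
    unfolding harm_def using assms by (intro sum_mono2) auto
  finally have 1: "(\<Sum>n=N..<m. 1 / \<bar>real m - real n\<bar>) \<le> harm N" .
  have "(\<Sum>n=Suc m..<2 * N. 1 / \<bar>real m - real n\<bar>) = (\<Sum>d=1..<2 * N - m. inverse (real d))"
    by (rule sum.reindex_bij_witness[of _ "\<lambda>d. m + d" "\<lambda>n. n - m"])
       (auto simp: of_nat_diff inverse_eq_divide)
  also have "\<dots> \<le> harm N"
    unfolding harm_def using assms by (intro sum_mono2) auto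
  finally have 2: "(\<Sum>n=Suc m..<2 * N. 1 / \<bar>real m - real n\<bar>) \<le> harm N" .
  show ?thesis
    unfolding split using 1 2 by (subst sum.union_disjoint) auto
qed

text \<open>
  The seminorm of \<open>L\<^sup>2\<close> of the segment with normalized measure. Working with the square root
  makes infinite sums of functions accessible through the triangle inequality.
\<close>

definition rms :: "real \<Rightarrow> (real \<Rightarrow> complex) \<Rightarrow> real" where
  "rms T f = sqrt (1 / (2 * T) * integral {-T..T} (\<lambda>t. (cmod (f t))\<^sup>2))"

lemma integrable_norm_square:
  fixes f :: "real \<Rightarrow> complex"
  assumes "continuous_on UNIV f"
  shows "(\<lambda>t. (cmod (f t))\<^sup>2) integrable_on {a..b}"
  by (intro integrable_continuous_real continuous_intros continuous_on_subset[OF assms]) auto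

lemma integral_norm_square_nonneg: "0 \<le> integral S (\<lambda>t. (cmod (f t))\<^sup>2)"
  by (cases "(\<lambda>t. (cmod (f t))\<^sup>2) integrable_on S")
     (auto intro: integral_nonneg simp: not_integrable_integral)

lemma rms_nonneg: "0 < T \<Longrightarrow> 0 \<le> rms T f"
  by (simp add: rms_def integral_norm_square_nonneg)

lemma rms_square:
  "0 < T \<Longrightarrow> (rms T f)\<^sup>2 = 1 / (2 * T) * integral {-T..T} (\<lambda>t. (cmod (f t))\<^sup>2)"
  by (simp add: rms_def integral_norm_square_nonneg)

lemma rms_le:
  fixes f :: "real \<Rightarrow> complex"
  assumes "0 < T" "0 \<le> C" and f: "continuous_on UNIV f" and le: "\<And>t. \<bar>t\<bar> \<le> T \<Longrightarrow> cmod (f t) \<le> C"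
  shows "rms T f \<le> C"
proof (rule power2_le_imp_le)
  have "integral {-T..T} (\<lambda>t. (cmod (f t))\<^sup>2) \<le> integral {-T..T} (\<lambda>t. C\<^sup>2)"
    using le by (intro integral_le integrable_norm_square f) (auto intro!: power_mono simp: abs_le_iff)
  then show "(rms T f)\<^sup>2 \<le> C\<^sup>2"
    using assms by (simp add: rms_square field_simps)
qed fact

text \<open>
  The pointwise inequality \<open>(x + y)\<^sup>2 \<le> (1 + b / a) x\<^sup>2 + (1 + a / b) y\<^sup>2\<close> is integrated
  with \<open>a\<close> and \<open>b\<close> slightly above the two seminorms; this choice is optimal and positive.
\<close>

lemma rms_triangle:
  fixes f g :: "real \<Rightarrow> complex"
  assumes T: "0 < T" and f: "continuous_on UNIV f" and g: "continuous_on UNIV g"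
  shows "rms T (\<lambda>t. f t + g t) \<le> rms T f + rms T g"
proof (rule field_le_epsilon)
  fix e :: real assume e: "0 < e"
  \<comment> \<open>The added \<open>e / 2\<close> keeps the divisors \<open>a\<close> and \<open>b\<close> positive.\<close>
  define a b where "a = rms T f + e / 2" and "b = rms T g + e / 2"
  have ab: "0 < a" "0 < b" "rms T f \<le> a" "rms T g \<le> b"
    using e rms_nonneg[OF T] by (auto simp: a_def b_def add_nonneg_pos)
  have pt: "(cmod (f t + g t))\<^sup>2 \<le> (1 + b / a) * (cmod (f t))\<^sup>2 + (1 + a / b) * (cmod (g t))\<^sup>2" for t
  proof -
    have "(cmod (f t + g t))\<^sup>2 \<le> (cmod (f t) + cmod (g t))\<^sup>2"
      by (intro power_mono norm_triangle_ineq) auto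
    also have "\<dots> \<le> \<dots> + a * b * (cmod (f t) / a - cmod (g t) / b)\<^sup>2"
      using ab by simp
    also have "\<dots> = (1 + b / a) * (cmod (f t))\<^sup>2 + (1 + a / b) * (cmod (g t))\<^sup>2"
      using ab by (simp add: power2_eq_square field_simps)
    finally show ?thesis .
  qed
  have "integral {-T..T} (\<lambda>t. (cmod (f t + g t))\<^sup>2)
      \<le> integral {-T..T} (\<lambda>t. (1 + b / a) * (cmod (f t))\<^sup>2 + (1 + a / b) * (cmod (g t))\<^sup>2)"
    using pt
    by (intro integral_le integrable_norm_square integrable_add integrable_on_mult_right continuous_on_add f g) auto
  also have "\<dots> = (1 + b / a) * integral {-T..T} (\<lambda>t. (cmod (f t))\<^sup>2)
      + (1 + a / b) * integral {-T..T} (\<lambda>t. (cmod (g t))\<^sup>2)"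
    by (subst integral_add) (auto intro!: integrable_norm_square integrable_on_mult_right f g)
  finally have "1 / (2 * T) * integral {-T..T} (\<lambda>t. (cmod (f t + g t))\<^sup>2)
      \<le> 1 / (2 * T) * ((1 + b / a) * integral {-T..T} (\<lambda>t. (cmod (f t))\<^sup>2)
          + (1 + a / b) * integral {-T..T} (\<lambda>t. (cmod (g t))\<^sup>2))"
    using T by (intro mult_left_mono) auto
  then have "(rms T (\<lambda>t. f t + g t))\<^sup>2 \<le> (1 + b / a) * (rms T f)\<^sup>2 + (1 + a / b) * (rms T g)\<^sup>2"
    unfolding rms_square[OF T] by (simp only: distrib_left mult.left_commute[of "1 / (2 * T)"])
  also have "\<dots> \<le> (1 + b / a) * a\<^sup>2 + (1 + a / b) * b\<^sup>2"
    using ab rms_nonneg[OF T] by (intro add_mono mult_left_mono power_mono) auto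
  also have "\<dots> = (a + b)\<^sup>2"
    using ab by (simp add: power2_eq_square field_simps)
  finally have "rms T (\<lambda>t. f t + g t) \<le> a + b"
    by (rule power2_le_imp_le) (use ab in auto)
  then show "rms T (\<lambda>t. f t + g t) \<le> rms T f + rms T g + e" by (simp add: a_def b_def)
qed

lemma rms_sum_le:
  fixes b :: "nat \<Rightarrow> real \<Rightarrow> complex"
  assumes T: "0 < T" and b: "\<And>j. continuous_on UNIV (b j)" and "finite A"
  shows "rms T (\<lambda>t. \<Sum>j\<in>A. b j t) \<le> (\<Sum>j\<in>A. rms T (b j))"
  using \<open>finite A\<close>
proof induction
  case empty
  then show ?case by (simp add: rms_def)
next
  case (insert j A)
  have "rms T (\<lambda>t. b j t + (\<Sum>j\<in>A. b j t)) \<le> rms T (b j) + rms T (\<lambda>t. \<Sum>j\<in>A. b j t)"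
    by (intro rms_triangle T b continuous_on_sum)
  then show ?case using insert by simp
qed

lemma tendsto_rms_dirichlet_polynomial:
  fixes c :: "nat \<Rightarrow> complex" and l :: "nat \<Rightarrow> real"
  assumes A: "finite A" "inj_on l A"
  shows "((\<lambda>T. rms T (\<lambda>t. \<Sum>n\<in>A. c n * cis (- t * l n)))
    \<longlongrightarrow> sqrt (\<Sum>n\<in>A. (cmod (c n))\<^sup>2)) at_top"
proof -
  define K where "K = (\<Sum>m\<in>A. \<Sum>n\<in>A - {m}. 2 * cmod (c m) * cmod (c n) / \<bar>l m - l n\<bar>)"
  define D where "D = (\<Sum>n\<in>A. (cmod (c n))\<^sup>2)"
  define M where "M T = 1 / (2 * T) * integral {-T..T} (\<lambda>t. (cmod (\<Sum>n\<in>A. c n * cis (- t * l n)))\<^sup>2)" for T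
  have "((\<lambda>T. M T - D) \<longlongrightarrow> 0) at_top"
  proof (rule Lim_null_comparison)
    have "norm (M T - D) \<le> K / (2 * T)" if "0 < T" for T
    proof -
      have "M T - D = (integral {-T..T} (\<lambda>t. (cmod (\<Sum>n\<in>A. c n * cis (- t * l n)))\<^sup>2) - 2 * T * D) / (2 * T)"
        using that by (simp add: M_def field_simps)
      also have "norm \<dots> \<le> K / (2 * T)"
        using mean_square_dirichlet_polynomial[OF A, of T c] that
        by (simp add: K_def D_def abs_divide divide_right_mono)
      finally show ?thesis .
    qed
    then show "\<forall>\<^sub>F T in at_top. norm (M T - D) \<le> K / (2 * T)"
      using eventually_gt_at_top[of "0::real"] by (rule eventually_mono[rotated])
    show "((\<lambda>T. K / (2 * T)) \<longlongrightarrow> 0) at_top"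
      by (intro tendsto_divide_0[OF tendsto_const] filterlim_at_top_imp_at_infinity
          filterlim_tendsto_pos_mult_at_top[OF tendsto_const] filterlim_ident) auto
  qed
  then have "(M \<longlongrightarrow> D) at_top" by (rule LIM_zero_cancel)
  then show ?thesis unfolding rms_def M_def D_def by (rule tendsto_real_sqrt)
qed

text \<open>
  An interchange of the limits \<open>T \<rightarrow> \<infinity>\<close> and \<open>J \<rightarrow> \<infinity>\<close>: a summable bound on the seminorms of
  the terms, uniform in \<open>T\<close>, makes the seminorms of the partial sums converge uniformly in \<open>T\<close>.
\<close>

lemma tendsto_rms_suminf:
  fixes b :: "nat \<Rightarrow> real \<Rightarrow> complex"
  assumes b: "\<And>j. continuous_on UNIV (b j)" and G: "continuous_on UNIV G"
    and \<delta>: "\<And>j T. 1 \<le> T \<Longrightarrow> rms T (b j) \<le> \<delta> j" "summable \<delta>"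
    and unif: "\<And>T. uniform_limit {-T..T} (\<lambda>J t. \<Sum>j<J. b j t) G sequentially"
    and lim: "\<And>J. ((\<lambda>T. rms T (\<lambda>t. \<Sum>j<J. b j t)) \<longlongrightarrow> d J) at_top"
    and d: "d \<longlonglongrightarrow> D"
  shows "((\<lambda>T. rms T G) \<longlongrightarrow> D) at_top"
proof (rule swap_uniform_limit'[where F = sequentially and S = "{1..}"])
  define P where "P = (\<lambda>J t. \<Sum>j<J. b j t)"
  have P: "continuous_on UNIV (P J)" for J
    unfolding P_def by (intro continuous_on_sum b)
  show "\<forall>\<^sub>F J in sequentially. ((\<lambda>T. rms T (P J)) \<longlongrightarrow> d J) at_top"
    unfolding P_def by (intro always_eventually allI lim)
  show "uniform_limit {1..} (\<lambda>J T. rms T (P J)) (\<lambda>T. rms T G) sequentially"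
  proof (rule uniform_limitI)
    fix e :: real assume e: "0 < e"
    obtain J0 where J0: "\<forall>J\<ge>J0. \<forall>K. norm (sum \<delta> {J..<K}) < e / 2"
      using \<delta>(2) e unfolding summable_Cauchy by (meson half_gt_zero)
    have "dist (rms T (P J)) (rms T G) < e" if J: "J0 \<le> J" and T: "1 \<le> T" for J T
    proof -
      have T0: "0 < T" using T by simp
      obtain K where K: "J \<le> K" "\<And>t. t \<in> {-T..T} \<Longrightarrow> dist (P K t) (G t) < e / 4"
      proof -
        have "\<forall>\<^sub>F K in sequentially. \<forall>t\<in>{-T..T}. dist (P K t) (G t) < e / 4"
          using uniform_limitD[OF unif[of T], of "e / 4"] e by (simp add: P_def)
        then obtain K0 where "\<forall>K\<ge>K0. \<forall>t\<in>{-T..T}. dist (P K t) (G t) < e / 4"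
          unfolding eventually_sequentially by blast
        then show ?thesis using that[of "max K0 J"] by simp
      qed
      have 1: "rms T (\<lambda>t. G t - P K t) \<le> e / 4"
        using K(2) e
        by (intro rms_le T0 continuous_on_diff G P) (auto simp: dist_norm norm_minus_commute abs_le_iff less_imp_le)
      have r1: "rms T (\<lambda>t. P K t - G t) \<le> e / 4"
        using 1 by (simp add: rms_def norm_minus_commute)
      have split: "P K t = P J t + (\<Sum>j=J..<K. b j t)" for t
        using K(1) unfolding P_def by (metis lessThan_atLeast0 sum.atLeastLessThan_concat zero_le)
      have "rms T (\<lambda>t. \<Sum>j=J..<K. b j t) \<le> (\<Sum>j=J..<K. \<delta> j)"
        by (intro order.trans[OF rms_sum_le[OF T0 b]] sum_mono \<delta>(1)[OF T]) simp
      also have "\<dots> < e / 2" using J0[rule_format, OF J, of K] unfolding real_norm_def by linarith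
      finally have 2: "rms T (\<lambda>t. \<Sum>j=J..<K. b j t) < e / 2" .
      have r2: "rms T (\<lambda>t. - (\<Sum>j=J..<K. b j t)) < e / 2"
        using 2 by (simp add: rms_def)
      have cs: "continuous_on UNIV (\<lambda>t. \<Sum>j=J..<K. b j t)" by (intro continuous_on_sum b)
      have "rms T G = rms T (\<lambda>t. (G t - P K t) + (P J t + (\<Sum>j=J..<K. b j t)))"
        by (simp add: split)
      also have "\<dots> \<le> rms T (\<lambda>t. G t - P K t) + rms T (\<lambda>t. P J t + (\<Sum>j=J..<K. b j t))"
        by (rule rms_triangle[OF T0 continuous_on_diff[OF G P] continuous_on_add[OF P cs]])
      also have "\<dots> \<le> rms T (\<lambda>t. G t - P K t) + (rms T (P J) + rms T (\<lambda>t. \<Sum>j=J..<K. b j t))"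
        by (rule add_left_mono[OF rms_triangle[OF T0 P cs]])
      finally have A: "rms T G - rms T (P J) < e" using 1 2 e by linarith
      have "rms T (P J) = rms T (\<lambda>t. (P K t - G t) + (G t + - (\<Sum>j=J..<K. b j t)))"
        by (simp add: split)
      also have "\<dots> \<le> rms T (\<lambda>t. P K t - G t) + rms T (\<lambda>t. G t + - (\<Sum>j=J..<K. b j t))"
        by (rule rms_triangle[OF T0 continuous_on_diff[OF P G] continuous_on_add[OF G continuous_on_minus[OF cs]]])
      also have "\<dots> \<le> rms T (\<lambda>t. P K t - G t) + (rms T G + rms T (\<lambda>t. - (\<Sum>j=J..<K. b j t)))"
        by (rule add_left_mono[OF rms_triangle[OF T0 G continuous_on_minus[OF cs]]])
      finally have B: "rms T (P J) - rms T G < e" using r1 r2 e by linarith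
      show ?thesis using A B by (simp add: dist_real_def abs_less_iff)
    qed
    then show "\<forall>\<^sub>F J in sequentially. \<forall>T\<in>{1..}. dist (rms T (P J)) (rms T G) < e"
      unfolding eventually_sequentially by auto
  qed
  show "\<forall>\<^sub>F T in at_top. T \<in> {1::real..}"
    using eventually_ge_at_top[of "1::real"] by simp
qed (use d in auto)

lemma tendsto_rms_zero:
  fixes f :: "real \<Rightarrow> complex"
  assumes f: "continuous_on UNIV f" and lim: "(f \<longlongrightarrow> 0) at_infinity"
  shows "((\<lambda>T. rms T f) \<longlongrightarrow> 0) at_top"
proof -
  let ?q = "\<lambda>t. (cmod (f t))\<^sup>2"
  have int: "?q integrable_on {a..b}" for a b
    by (rule integrable_norm_square[OF f])
  have "((\<lambda>T. (rms T f)\<^sup>2) \<longlongrightarrow> 0) at_top"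
  proof (rule tendstoI)
    fix e :: real assume e: "0 < e"
    have "\<forall>\<^sub>F t in at_infinity. ?q t < e / 2"
      using tendstoD[OF tendsto_power[OF tendsto_norm[OF lim], of 2], of "e / 2"] e
      by (simp add: dist_real_def)
    then obtain R where R: "\<And>t. R \<le> \<bar>t\<bar> \<Longrightarrow> ?q t < e / 2"
      unfolding eventually_at_infinity by auto
    define C where "C = integral {-\<bar>R\<bar>..\<bar>R\<bar>} ?q"
    have C0: "0 \<le> C" unfolding C_def by (rule integral_norm_square_nonneg)
    have bound: "(rms T f)\<^sup>2 < e" if T: "T > \<bar>R\<bar> + C / e" "T > 0" for T
    proof -
      have "C / e \<ge> 0" using C0 e by simp
      then have RT: "\<bar>R\<bar> \<le> T" using T by linarith
      have "integral {-T..T} ?q = integral {-T..-\<bar>R\<bar>} ?q + integral {-\<bar>R\<bar>..T} ?q"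
        using RT by (intro Henstock_Kurzweil_Integration.integral_combine[symmetric] int) auto
      also have "integral {-\<bar>R\<bar>..T} ?q = C + integral {\<bar>R\<bar>..T} ?q"
        unfolding C_def using RT by (intro Henstock_Kurzweil_Integration.integral_combine[symmetric] int) auto
      also have "integral {\<bar>R\<bar>..T} ?q \<le> integral {\<bar>R\<bar>..T} (\<lambda>_. e / 2)"
        using R by (intro integral_le int) (auto intro: less_imp_le)
      also have "integral {-T..-\<bar>R\<bar>} ?q \<le> integral {-T..-\<bar>R\<bar>} (\<lambda>_. e / 2)"
        using R by (intro integral_le int) (auto intro: less_imp_le)
      finally have "integral {-T..T} ?q \<le> C + (T - \<bar>R\<bar>) * e"
        using RT by (simp add: mult.commute)
      also have "\<dots> \<le> C + T * e" using e by (simp add: mult_right_mono)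
      also have "\<dots> < 2 * T * e"
        using T \<open>0 \<le> C / e\<close> e by (simp add: field_simps) (smt (verit) mult_nonneg_nonneg abs_ge_zero)
      finally show ?thesis
        using T by (simp add: rms_square field_simps)
    qed
    have "\<forall>\<^sub>F T in at_top. (rms T f)\<^sup>2 < e"
      using eventually_gt_at_top[of "\<bar>R\<bar> + C / e"] eventually_gt_at_top[of 0]
      by eventually_elim (rule bound)
    then show "\<forall>\<^sub>F T in at_top. dist ((rms T f)\<^sup>2) 0 < e"
      by (simp add: dist_real_def)
  qed
  then have "((\<lambda>T. sqrt ((rms T f)\<^sup>2)) \<longlongrightarrow> sqrt 0) at_top" by (rule tendsto_real_sqrt)
  then have "((\<lambda>T. \<bar>rms T f\<bar>) \<longlongrightarrow> 0) at_top" by simp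
  then show ?thesis by (simp add: tendsto_rabs_zero_iff)
qed

section \<open>Dyadic blocks and their weights\<close>

text \<open>
  With doubly exponential growth each block start is the square of its predecessor, so that earlier
  blocks are negligible where a later one peaks, and \<open>log\<^sub>2\<close> of a block start is the inverse of
  the weight below.
\<close>

definition block_start :: "nat \<Rightarrow> nat" where
  "block_start j = 2 ^ (2 ^ j)"

definition block :: "nat \<Rightarrow> nat set" where
  "block j = {block_start j..<2 * block_start j}"

definition weight :: "nat \<Rightarrow> real" where
  "weight j = (1 / 2) ^ j"

lemma block_start_ge: "2 \<le> block_start j"
  unfolding block_start_def using power_increasing[of 1 "2 ^ j" "2::nat"] by simp

lemma block_start_pos [simp]: "0 < block_start j"
  by (simp add: block_start_def)

lemma block_start_nonzero [simp]: "block_start j \<noteq> 0"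
  by (simp add: block_start_def)

lemma less_block_start: "j < block_start j"
proof -
  have "j < 2 ^ j" by simp
  also have "\<dots> < 2 ^ (2 ^ j)" by simp
  finally show ?thesis by (simp add: block_start_def)
qed

lemma block_start_Suc: "block_start (Suc j) = (block_start j)\<^sup>2"
  by (simp add: block_start_def power_mult power2_eq_square flip: power_add mult_2)

lemma two_block_start_le_Suc: "2 * block_start j \<le> block_start (Suc j)"
  unfolding block_start_Suc power2_eq_square using block_start_ge by (intro mult_right_mono) auto

lemma two_block_start_le: "i < j \<Longrightarrow> 2 * block_start i \<le> block_start j"
proof (induction j)
  case (Suc j)
  show ?case
  proof (cases "i = j")
    case True
    then show ?thesis using two_block_start_le_Suc by simp
  next
    case False
    then show ?thesis using Suc two_block_start_le_Suc[of j] by simp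
  qed
qed simp

lemma block_start_mono: "i \<le> j \<Longrightarrow> block_start i \<le> block_start j"
  using two_block_start_le[of i j] by (cases "i = j") auto

lemma finite_block [simp]: "finite (block j)"
  and card_block [simp]: "card (block j) = block_start j"
  by (simp_all add: block_def)

lemma block_disjoint: "n \<in> block i \<Longrightarrow> n \<in> block j \<Longrightarrow> i = j"
  using two_block_start_le[of i j] two_block_start_le[of j i]
  by (auto simp: block_def not_less_iff_gr_or_eq dest: linorder_neqE_nat)

lemma less_of_mem_block: "n \<in> block j \<Longrightarrow> j < n"
  using less_block_start[of j] by (auto simp: block_def)

lemma weight_pos [simp]: "0 < weight j"
  by (simp add: weight_def)

lemma weight_nonneg [simp]: "0 \<le> weight j"
  by (simp add: weight_def)

lemma weight_le_1: "weight j \<le> 1"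
  by (simp add: weight_def power_le_one)

lemma weight_sums: "weight sums 2"
  unfolding weight_def using geometric_sums[of "1 / 2 :: real"] by simp

lemma summable_weight: "summable weight"
  using weight_sums by (rule sums_summable)

lemma harm_block_start_le: "harm (block_start j) \<le> 2 / weight j"
proof -
  have "harm (Suc n) - ln (real (Suc n)) \<le> (1 :: real)" for n
    using decseqD[OF decseq_harm_diff_ln, of 0 n] by (simp add: harm_expand)
  from this[of "block_start j - 1"]
  have "harm (block_start j) \<le> 1 + ln (real (block_start j))" by simp
  also have "ln (real (block_start j)) = 2 ^ j * ln 2"
    by (simp add: block_start_def ln_realpow)
  also have "1 + 2 ^ j * ln 2 \<le> 1 + 2 ^ j * (1::real)"
    using ln_2_less_1 by (intro add_left_mono mult_left_mono) auto
  also have "\<dots> \<le> 2 * 2 ^ j"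
    by simp
  also have "\<dots> = 2 / weight j"
    by (simp add: weight_def power_divide)
  finally show ?thesis .
qed

text \<open>
  The mean value theorem for a dyadic Dirichlet polynomial, with the logarithmic factor
  of the off-diagonal terms written as an inverse weight.
\<close>

lemma integral_block_polynomial_le:
  fixes c :: "nat \<Rightarrow> complex"
  assumes T: "0 \<le> T" and q: "\<And>n. n \<in> block j \<Longrightarrow> cmod (c n) \<le> q"
  shows "integral {-T..T} (\<lambda>t. (cmod (\<Sum>n\<in>block j. c n * cis (- t * ln (real n))))\<^sup>2)
    \<le> 2 * T * (real (block_start j) * q\<^sup>2) + 16 * (real (block_start j))\<^sup>2 * q\<^sup>2 / weight j"
proof -
  let ?N = "block_start j"
  have q0: "0 \<le> q"
    by (rule order.trans[OF norm_ge_zero q[of ?N]]) (simp add: block_def)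
  have inj: "inj_on (\<lambda>n. ln (real n)) (block j)"
  proof (rule inj_onI)
    fix m n assume mn: "m \<in> block j" "n \<in> block j" "ln (real m) = ln (real n)"
    then have "0 < real m" "0 < real n" by (auto dest: less_of_mem_block)
    with mn show "m = n" using ln_inj_iff by auto
  qed
  have "(\<Sum>m\<in>block j. \<Sum>n\<in>block j - {m}. 2 * cmod (c m) * cmod (c n) / \<bar>ln (real m) - ln (real n)\<bar>)
      \<le> (\<Sum>m\<in>block j. 8 * real ?N * q\<^sup>2 * (2 / weight j))"
  proof (intro sum_mono)
    fix m assume m: "m \<in> block j"
    have "(\<Sum>n\<in>block j - {m}. 2 * cmod (c m) * cmod (c n) / \<bar>ln (real m) - ln (real n)\<bar>)
        \<le> (\<Sum>n\<in>block j - {m}. 4 * real ?N * q\<^sup>2 * (1 / \<bar>real m - real n\<bar>))"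
    proof (intro sum_mono)
      fix n assume n: "n \<in> block j - {m}"
      have "2 * cmod (c m) * cmod (c n) * (1 / \<bar>ln (real m) - ln (real n)\<bar>)
          \<le> 2 * q * q * (2 * real ?N / \<bar>real m - real n\<bar>)"
        using m n q q0
        by (intro mult_mono inverse_ln_diff_le) (auto simp: block_def)
      then show "2 * cmod (c m) * cmod (c n) / \<bar>ln (real m) - ln (real n)\<bar>
          \<le> 4 * real ?N * q\<^sup>2 * (1 / \<bar>real m - real n\<bar>)"
        by (simp add: power2_eq_square mult_ac)
    qed
    also have "\<dots> \<le> 4 * real ?N * q\<^sup>2 * (2 * harm ?N)"
      unfolding sum_distrib_left[symmetric] using m
      by (intro mult_left_mono) (auto simp: block_def intro!: sum_inverse_distance_le)
    also have "\<dots> \<le> 4 * real ?N * q\<^sup>2 * (2 * (2 / weight j))"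
      by (intro mult_left_mono harm_block_start_le) auto
    finally show "(\<Sum>n\<in>block j - {m}. 2 * cmod (c m) * cmod (c n) / \<bar>ln (real m) - ln (real n)\<bar>)
        \<le> 8 * real ?N * q\<^sup>2 * (2 / weight j)"
      by simp
  qed
  also have "\<dots> = 16 * (real ?N)\<^sup>2 * q\<^sup>2 / weight j"
    by (simp add: power2_eq_square)
  finally have off: "(\<Sum>m\<in>block j. \<Sum>n\<in>block j - {m}. 2 * cmod (c m) * cmod (c n) / \<bar>ln (real m) - ln (real n)\<bar>)
      \<le> 16 * (real ?N)\<^sup>2 * q\<^sup>2 / weight j" .
  have "(\<Sum>n\<in>block j. (cmod (c n))\<^sup>2) \<le> (\<Sum>n\<in>block j. q\<^sup>2)"
    using q by (intro sum_mono power_mono) auto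
  then have "2 * T * (\<Sum>n\<in>block j. (cmod (c n))\<^sup>2) \<le> 2 * T * (real ?N * q\<^sup>2)"
    using T by (intro mult_left_mono) auto
  with mean_square_dirichlet_polynomial[OF finite_block inj T, of c] off show ?thesis
    by linarith
qed

text \<open>
  The weights decay more slowly than any negative power of the block starts, so they do not affect
  the exponents.
\<close>

lemma weight_mult_powr_at_top:
  assumes "0 < \<beta>"
  shows "filterlim (\<lambda>j. weight j * real (block_start j) powr \<beta>) at_top sequentially"
proof (rule filterlim_at_top_mono)
  define b where "b = \<beta> * ln 2"
  have b: "0 < b" using assms by (simp add: b_def)
  show "filterlim (\<lambda>j. b\<^sup>2 / 2 * real j) at_top sequentially"
    using b by (intro filterlim_tendsto_pos_mult_at_top[OF tendsto_const] filterlim_real_sequentially) auto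
  have "b\<^sup>2 / 2 * real j \<le> weight j * real (block_start j) powr \<beta>" for j
  proof -
    have "real (block_start j) powr \<beta> = exp (b * 2 ^ j)"
      by (simp add: powr_def block_start_def ln_realpow b_def mult_ac)
    moreover have "(b * 2 ^ j)\<^sup>2 / 2 \<le> exp (b * 2 ^ j)"
      using exp_lower_Taylor_quadratic[of "b * 2 ^ j"] b
      by (smt (verit) mult_nonneg_nonneg zero_le_power)
    ultimately have "weight j * ((b * 2 ^ j)\<^sup>2 / 2) \<le> weight j * real (block_start j) powr \<beta>"
      by (intro mult_left_mono) auto
    moreover have "weight j * ((b * 2 ^ j)\<^sup>2 / 2) = b\<^sup>2 / 2 * 2 ^ j"
      by (simp add: weight_def power_divide power2_eq_square)
    moreover have "b\<^sup>2 / 2 * real j \<le> b\<^sup>2 / 2 * 2 ^ j"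
      using of_nat_less_two_power[of j] by (intro mult_left_mono) (auto intro: less_imp_le)
    ultimately show ?thesis by linarith
  qed
  then show "\<forall>\<^sub>F j in sequentially. b\<^sup>2 / 2 * real j \<le> weight j * real (block_start j) powr \<beta>"
    by simp
qed

section \<open>Size of the blocks\<close>

locale dyadic_dirichlet_series =
  fixes \<theta> :: real
  assumes \<theta>_gt: "- (1 / 2) < \<theta>" and \<theta>_lt: "\<theta> < 1 / 2"
begin

text \<open>
  The exponent is dictated by the abscissa of convergence: on the real axis cancellation gains a
  factor \<open>freq j\<close> over the trivial bound \<open>N powr (1 / 2 - \<sigma>)\<close>, leaving \<open>N powr (\<theta> - \<sigma>)\<close>.
\<close>

definition freq :: "nat \<Rightarrow> real" where
  "freq j = real (block_start j) powr (1 / 2 - \<theta>)"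

text \<open>
  At most one summand is nonzero, since the blocks are disjoint; the range \<open>j < n\<close> loses nothing
  because the \<open>j\<close>-th block lies beyond \<open>j\<close>. Defining the value by a sum avoids choosing the block
  that contains \<open>n\<close>.
\<close>

definition coef :: "nat \<Rightarrow> complex" where
  "coef n = (\<Sum>j<n. if n \<in> block j
     then of_real (weight j * real (block_start j) powr - (1 / 2)) * cis (freq j * ln (real n)) else 0)"

text \<open>
  The terms indexed by \<open>n\<close> itself and not by \<open>n - 1\<close>, so that blocks of integers can be summed without a shift.
\<close>

definition gterm :: "complex \<Rightarrow> nat \<Rightarrow> complex" where
  "gterm s n = coef n * of_nat n powr - s"

definition block_sum :: "nat \<Rightarrow> complex \<Rightarrow> complex" where
  "block_sum j s = (\<Sum>n\<in>block j. gterm s n)"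

lemma freq_pos: "0 < freq j"
  by (simp add: freq_def)

lemma freq_le: "freq j \<le> real (block_start j)"
  using powr_mono[of "1 / 2 - \<theta>" 1 "real (block_start j)"] \<theta>_gt block_start_ge[of j]
  by (simp add: freq_def)

lemma coef_block:
  assumes "n \<in> block j"
  shows "coef n = of_real (weight j * real (block_start j) powr - (1 / 2)) * cis (freq j * ln (real n))"
proof -
  have "coef n = (\<Sum>i<n. if i = j
     then of_real (weight j * real (block_start j) powr - (1 / 2)) * cis (freq j * ln (real n)) else 0)"
    unfolding coef_def using assms by (intro sum.cong refl) (auto dest: block_disjoint)
  then show ?thesis using less_of_mem_block[OF assms] by simp
qed

lemma coef_not_block: "(\<And>j. n \<notin> block j) \<Longrightarrow> coef n = 0"
  by (simp add: coef_def)

lemma norm_coef_block: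
  "n \<in> block j \<Longrightarrow> cmod (coef n) = weight j * real (block_start j) powr - (1 / 2)"
  by (simp add: coef_block norm_mult)

lemma gterm_0: "gterm s 0 = 0"
  by (simp add: gterm_def)

lemma dirichlet_term_eq_gterm: "dirichlet_term coef s k = gterm s (Suc k)"
  by (simp add: dirichlet_term_def gterm_def)

lemma gterm_block:
  assumes "n \<in> block j"
  shows "gterm s n = of_real (weight j * real (block_start j) powr - (1 / 2)) *
    (of_real (real n powr - Re s) * cis ((freq j - Im s) * ln (real n)))"
proof -
  have "n > 0" using less_of_mem_block[OF assms] by simp
  then show ?thesis
    unfolding gterm_def coef_block[OF assms] of_nat_powr_eq_cis[OF \<open>n > 0\<close>]
    by (simp add: cis_mult left_diff_distrib mult.assoc mult.left_commute[of "cis _" "of_real _"])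
qed

lemma norm_gterm_block:
  "n \<in> block j \<Longrightarrow> cmod (gterm s n) = weight j * real (block_start j) powr - (1 / 2) * real n powr - Re s"
  by (simp add: gterm_block norm_mult)

lemma sum_block_norm_le:
  assumes "- 1 \<le> Re s" and "A \<subseteq> block j"
  shows "(\<Sum>n\<in>A. cmod (gterm s n)) \<le> 2 * weight j * real (block_start j) powr (1 / 2 - Re s)"
proof -
  let ?N = "real (block_start j)"
  have "(\<Sum>n\<in>A. cmod (gterm s n)) \<le> (\<Sum>n\<in>block j. cmod (gterm s n))"
    using assms by (intro sum_mono2) auto
  also have "\<dots> \<le> (\<Sum>n\<in>block j. weight j * ?N powr - (1 / 2) * (2 * ?N powr - Re s))"
  proof (intro sum_mono)
    fix n assume n: "n \<in> block j"
    then have "real n powr - Re s \<le> 2 * ?N powr - Re s"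
      using assms by (intro powr_dyadic_le) (auto simp: block_def)
    then show "cmod (gterm s n) \<le> weight j * ?N powr - (1 / 2) * (2 * ?N powr - Re s)"
      unfolding norm_gterm_block[OF n] by (intro mult_left_mono) auto
  qed
  also have "\<dots> = 2 * weight j * (?N powr 1 * ?N powr - (1 / 2) * ?N powr - Re s)"
    by simp
  also have "\<dots> = 2 * weight j * ?N powr (1 / 2 - Re s)"
    unfolding powr_add[symmetric] by (simp add: field_simps)
  finally show ?thesis .
qed

lemma norm_partial_block_le:
  assumes "- 1 \<le> Re s" and "A \<subseteq> block j"
  shows "cmod (\<Sum>n\<in>A. gterm s n) \<le> 2 * weight j * real (block_start j) powr (1 / 2 - Re s)"
  by (intro order.trans[OF norm_sum] sum_block_norm_le assms)

text \<open>
  For \<open>2 \<bar>t\<bar> \<le> freq j\<close> the phase \<open>freq j - t\<close> is comparable with \<open>freq j\<close>, which does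
  not exceed the block start, so the exponential sum bound applies to all partial sums of the block.
\<close>

lemma norm_partial_block_le_small_height:
  assumes "- 1 \<le> Re s" and "2 * \<bar>Im s\<bar> \<le> freq j"
    and AB: "block_start j \<le> A" "B \<le> 2 * block_start j"
  shows "cmod (\<Sum>n=A..<B. gterm s n) \<le> 96 * weight j * real (block_start j) powr (\<theta> - Re s)"
proof -
  let ?N = "real (block_start j)"
  define \<phi> where "\<phi> = freq j - Im s"
  have \<phi>: "freq j / 2 \<le> \<phi>" "\<phi> \<le> 3 / 2 * ?N"
    using assms freq_le[of j] by (auto simp: \<phi>_def)
  have "(\<Sum>n=A..<B. gterm s n) = of_real (weight j * ?N powr - (1 / 2)) *
      (\<Sum>n=A..<B. of_real (real n powr - Re s) * cis (\<phi> * ln (real n)))"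
    unfolding sum_distrib_left \<phi>_def using AB
    by (intro sum.cong refl gterm_block) (auto simp: block_def)
  then have "cmod (\<Sum>n=A..<B. gterm s n) = weight j * ?N powr - (1 / 2) *
      cmod (\<Sum>n=A..<B. of_real (real n powr - Re s) * cis (\<phi> * ln (real n)))"
    by (simp add: norm_mult)
  also have "\<dots> \<le> weight j * ?N powr - (1 / 2) * (48 * ?N powr (1 - Re s) / \<phi>)"
    using assms \<phi> freq_pos[of j] by (intro mult_left_mono norm_sum_powr_cis_ln_le) auto
  also have "\<dots> \<le> weight j * ?N powr - (1 / 2) * (48 * ?N powr (1 - Re s) / (freq j / 2))"
    using \<phi> freq_pos[of j] by (intro mult_left_mono divide_left_mono mult_pos_pos) auto
  also have "\<dots> = 96 * weight j * (?N powr - (1 / 2) * (?N powr (1 - Re s) / ?N powr (1 / 2 - \<theta>)))"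
    by (simp add: freq_def)
  also have "\<dots> = 96 * weight j * ?N powr (\<theta> - Re s)"
  proof -
    have "- (1 / 2) + ((1 - Re s) - (1 / 2 - \<theta>)) = \<theta> - Re s" by simp
    then show ?thesis unfolding powr_diff[symmetric] powr_add[symmetric] by simp
  qed
  finally show ?thesis .
qed

text \<open>
  Cancellation settles small heights. At large heights the trivial bound suffices: for
  \<open>\<sigma> \<ge> \<theta>\<close> it is at most \<open>freq j\<close> by the choice of the frequencies, and so at most \<open>2 \<bar>t\<bar>\<close>.
  Summability over \<open>j\<close> then rests on the weights alone.
\<close>

lemma norm_partial_block_le_uniform:
  assumes "\<theta> \<le> Re s" and AB: "block_start j \<le> A" "B \<le> 2 * block_start j"
  shows "cmod (\<Sum>n=A..<B. gterm s n) \<le> 96 * weight j * (1 + \<bar>Im s\<bar>)"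
proof (cases "2 * \<bar>Im s\<bar> \<le> freq j")
  case True
  have "real (block_start j) powr (\<theta> - Re s) \<le> real (block_start j) powr 0"
    using assms block_start_ge[of j] by (intro powr_mono) auto
  then have "real (block_start j) powr (\<theta> - Re s) \<le> 1 + \<bar>Im s\<bar>" by simp
  then have "96 * weight j * real (block_start j) powr (\<theta> - Re s) \<le> 96 * weight j * (1 + \<bar>Im s\<bar>)"
    by (intro mult_left_mono) auto
  moreover have "cmod (\<Sum>n=A..<B. gterm s n) \<le> 96 * weight j * real (block_start j) powr (\<theta> - Re s)"
    using assms \<theta>_gt True by (intro norm_partial_block_le_small_height) auto
  ultimately show ?thesis by linarith
next
  case False
  have "cmod (\<Sum>n=A..<B. gterm s n) \<le> 2 * weight j * real (block_start j) powr (1 / 2 - Re s)"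
    using assms \<theta>_gt by (intro norm_partial_block_le) (auto simp: block_def)
  also have "real (block_start j) powr (1 / 2 - Re s) \<le> freq j"
    unfolding freq_def using assms block_start_ge[of j] by (intro powr_mono) auto
  then have "2 * weight j * real (block_start j) powr (1 / 2 - Re s) \<le> 2 * weight j * freq j"
    by (intro mult_left_mono) auto
  also have "\<dots> \<le> 96 * weight j * (1 + \<bar>Im s\<bar>)"
    using False mult_left_mono[of "freq j" "48 * (1 + \<bar>Im s\<bar>)" "2 * weight j"] by simp
  finally show ?thesis .
qed

lemma norm_block_sum_le_uniform:
  "\<theta> \<le> Re s \<Longrightarrow> cmod (block_sum j s) \<le> 96 * weight j * (1 + \<bar>Im s\<bar>)"
  unfolding block_sum_def block_def by (rule norm_partial_block_le_uniform) auto

text \<open>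
  On the segment the phases, taken relative to the first one, stay within \<open>[-1, 1]\<close>, where the
  cosine is at least \<open>1 / 2\<close>; hence there is no cancellation. The whole block is such a segment at
  heights within \<open>1\<close> of the frequency, and an initial piece of length \<open>N / freq j\<close> is one at height
  \<open>0\<close>.
\<close>

lemma norm_initial_segment_ge:
  assumes s: "Re s \<le> 1" and M: "M \<le> block_start j"
    and \<phi>: "\<bar>freq j - Im s\<bar> * (real M / real (block_start j)) \<le> 1"
  shows "weight j * real (block_start j) powr (- (1 / 2) - Re s) * real M / 4
    \<le> cmod (\<Sum>n=block_start j..<block_start j + M. gterm s n)"
proof -
  let ?N = "block_start j"
  define \<phi> where "\<phi> = freq j - Im s"
  define a where "a = weight j * real ?N powr - (1 / 2)"
  have a: "0 \<le> a" by (simp add: a_def)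
  have main: "a * (real ?N powr - Re s / 2) * (1 / 2) \<le> Re (cis (- \<phi> * ln (real ?N)) * gterm s n)"
    if n: "n \<in> {?N..<?N + M}" for n
  proof -
    have nb: "n \<in> block j" using n M by (auto simp: block_def)
    have n0: "0 < n" using less_of_mem_block[OF nb] by simp
    have "cis (- \<phi> * ln (real ?N)) * gterm s n =
        of_real (a * real n powr - Re s) * cis (\<phi> * (ln (real n) - ln (real ?N)))"
      unfolding gterm_block[OF nb] \<phi>_def[symmetric] a_def[symmetric]
      by (simp add: cis_mult right_diff_distrib mult.left_commute[of "cis _" "of_real _"])
    then have re: "Re (cis (- \<phi> * ln (real ?N)) * gterm s n) =
        a * real n powr - Re s * cos (\<phi> * (ln (real n) - ln (real ?N)))"
      by simp
    have ln_pos: "0 \<le> ln (real n) - ln (real ?N)"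
      using n n0 by simp
    have "ln (real n) - ln (real ?N) = ln (real n / real ?N)"
      using n0 by (simp add: ln_div)
    also have "\<dots> \<le> real n / real ?N - 1"
      using n0 by (intro ln_le_minus_one) auto
    also have "\<dots> = (real n - real ?N) / real ?N"
      by (simp add: diff_divide_distrib)
    also have "\<dots> \<le> real M / real ?N"
      using n by (intro divide_right_mono) auto
    finally have "ln (real n) - ln (real ?N) \<le> real M / real ?N" .
    with ln_pos have "\<bar>\<phi> * (ln (real n) - ln (real ?N))\<bar> \<le> \<bar>\<phi>\<bar> * (real M / real ?N)"
      unfolding abs_mult by (intro mult_left_mono) auto
    with \<phi> have 1: "1 / 2 \<le> cos (\<phi> * (ln (real n) - ln (real ?N)))"
      unfolding \<phi>_def by (intro cos_ge_half) linarith
    have 2: "a * (real ?N powr - Re s / 2) \<le> a * real n powr - Re s"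
      using nb s a by (intro mult_left_mono powr_dyadic_ge) (auto simp: block_def)
    show ?thesis
      unfolding re by (rule mult_mono[OF 2 1]) (use a in auto)
  qed
  have "real ?N powr (- (1 / 2) - Re s) = real ?N powr - (1 / 2) * real ?N powr - Re s"
    unfolding powr_add[symmetric] by simp
  then have "weight j * real ?N powr (- (1 / 2) - Re s) * real M / 4 =
      (\<Sum>n=?N..<?N + M. a * (real ?N powr - Re s / 2) * (1 / 2))"
    by (simp add: a_def)
  also have "\<dots> \<le> (\<Sum>n=?N..<?N + M. Re (cis (- \<phi> * ln (real ?N)) * gterm s n))"
    by (intro sum_mono main)
  also have "\<dots> = Re (cis (- \<phi> * ln (real ?N)) * (\<Sum>n=?N..<?N + M. gterm s n))"
    by (simp only: sum_distrib_left Re_sum)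
  also have "\<dots> \<le> cmod (\<Sum>n=?N..<?N + M. gterm s n)"
    using complex_Re_le_cmod[of "cis (- \<phi> * ln (real ?N)) * (\<Sum>n=?N..<?N + M. gterm s n)"]
    by (simp add: norm_mult)
  finally show ?thesis .
qed

lemma norm_block_sum_ge:
  assumes s: "Re s \<le> 1" and t: "\<bar>freq j - Im s\<bar> \<le> 1"
  shows "weight j * real (block_start j) powr (1 / 2 - Re s) / 4 \<le> cmod (block_sum j s)"
proof -
  let ?N = "real (block_start j)"
  have "weight j * ?N powr (- (1 / 2) - Re s) * ?N / 4 \<le> cmod (block_sum j s)"
    using norm_initial_segment_ge[of s "block_start j" j] assms
    by (simp add: block_sum_def block_def mult_2)
  moreover have "?N powr (- (1 / 2) - Re s) * ?N = ?N powr (1 / 2 - Re s)"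
  proof -
    have "?N powr (- (1 / 2) - Re s) * ?N powr 1 = ?N powr (1 / 2 - Re s)"
      unfolding powr_add[symmetric] by (simp add: algebra_simps)
    then show ?thesis by simp
  qed
  ultimately show ?thesis by (metis mult.assoc)
qed

section \<open>Convergence and finite order\<close>

lemma sum_lessThan_eq_sum_blocks:
  fixes f :: "nat \<Rightarrow> 'b :: comm_monoid_add"
  assumes "\<And>n. (\<And>j. n \<notin> block j) \<Longrightarrow> f n = 0"
  shows "(\<Sum>n<K. f n) = (\<Sum>j<K. \<Sum>n\<in>block j \<inter> {..<K}. f n)"
proof -
  have "(\<Sum>j<K. \<Sum>n\<in>block j \<inter> {..<K}. f n) = sum f (\<Union>j<K. block j \<inter> {..<K})"
    by (subst sum.UNION_disjoint) (auto dest: block_disjoint)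
  also have "\<dots> = sum f {..<K}"
  proof (rule sum.mono_neutral_left)
    show "\<forall>n\<in>{..<K} - (\<Union>j<K. block j \<inter> {..<K}). f n = 0"
    proof
      fix n assume n: "n \<in> {..<K} - (\<Union>j<K. block j \<inter> {..<K})"
      have "n \<notin> block j" for j
      proof
        assume "n \<in> block j"
        with less_of_mem_block[OF this] n show False by auto
      qed
      then show "f n = 0" by (rule assms)
    qed
  qed auto
  finally show ?thesis by simp
qed

lemma gterm_not_block: "(\<And>j. n \<notin> block j) \<Longrightarrow> gterm s n = 0"
  by (simp add: gterm_def coef_not_block)

lemma block_Int_lessThan: "block j \<inter> {..<K} = {block_start j..<min (2 * block_start j) K}"
  by (auto simp: block_def)

text \<open>
  Grouping a convergent series into blocks is harmless, the converse is not: here the bound holds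
  for incomplete blocks as well, so dominated convergence for sums identifies the limit of the ungrouped
  partial sums.
\<close>

lemma tendsto_sum_gterm:
  assumes s: "\<theta> \<le> Re s"
  shows "(\<lambda>K. \<Sum>n<K. gterm s n) \<longlonglongrightarrow> (\<Sum>j. block_sum j s)"
proof -
  define part where "part j K = (\<Sum>n\<in>block j \<inter> {..<K}. gterm s n)" for j K
  have part_0: "part j K = 0" if "K \<le> j" for j K
  proof -
    have "block j \<inter> {..<K} = {}"
      using that less_of_mem_block[of _ j] unfolding disjoint_iff by force
    then show ?thesis by (simp add: part_def)
  qed
  have "(\<lambda>K. suminf (\<lambda>j. part j K)) \<longlonglongrightarrow> (\<Sum>j. block_sum j s)"
  proof (rule tannerys_theorem[THEN conjunct2, THEN conjunct2])
    show "(part j \<longlongrightarrow> block_sum j s) sequentially" for j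
    proof (rule tendsto_eventually)
      have "block j \<inter> {..<K} = block j" if "2 * block_start j \<le> K" for K
        using that by (auto simp: block_def)
      then show "\<forall>\<^sub>F K in sequentially. part j K = block_sum j s"
        unfolding eventually_sequentially part_def block_sum_def by metis
    qed
    have "cmod (part j K) \<le> 96 * weight j * (1 + \<bar>Im s\<bar>)" for j K
      unfolding part_def block_Int_lessThan by (intro norm_partial_block_le_uniform s) auto
    then show "\<forall>\<^sub>F (j, K) in sequentially \<times>\<^sub>F sequentially. cmod (part j K) \<le> 96 * weight j * (1 + \<bar>Im s\<bar>)"
      by (intro always_eventually) auto
    show "summable (\<lambda>j. 96 * weight j * (1 + \<bar>Im s\<bar>))"
      by (intro summable_mult2 summable_mult summable_weight)
  qed auto
  also have "(\<lambda>K. suminf (\<lambda>j. part j K)) = (\<lambda>K. \<Sum>n<K. gterm s n)"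
  proof
    fix K
    have "suminf (\<lambda>j. part j K) = (\<Sum>j<K. part j K)"
      by (rule suminf_finite) (auto intro: part_0)
    also have "\<dots> = (\<Sum>n<K. gterm s n)"
      unfolding part_def by (rule sum_lessThan_eq_sum_blocks[symmetric]) (rule gterm_not_block)
    finally show "suminf (\<lambda>j. part j K) = (\<Sum>n<K. gterm s n)" .
  qed
  finally show ?thesis .
qed

lemma dirichlet_term_sums:
  assumes s: "\<theta> \<le> Re s"
  shows "dirichlet_term coef s sums (\<Sum>j. block_sum j s)"
proof -
  have "(\<Sum>n<Suc K. gterm s n) = (\<Sum>k<K. dirichlet_term coef s k)" for K
    by (simp add: sum.lessThan_Suc_shift gterm_0 dirichlet_term_eq_gterm del: sum.lessThan_Suc)
  with LIMSEQ_Suc[OF tendsto_sum_gterm[OF s]] show ?thesis by (simp add: sums_def del: sum.lessThan_Suc)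
qed

lemma dirichlet_sum_eq: "\<theta> \<le> Re s \<Longrightarrow> dirichlet_sum coef s = (\<Sum>j. block_sum j s)"
  unfolding dirichlet_sum_def by (rule sums_unique[symmetric, OF dirichlet_term_sums])

lemma summable_norm_block_sum:
  assumes "\<theta> \<le> Re s"
  shows "summable (\<lambda>j. cmod (block_sum j s))"
  using norm_block_sum_le_uniform[OF assms]
  by (intro summable_comparison_test'[OF summable_mult2[OF summable_mult[OF summable_weight]]]) auto

lemma uniform_limit_block_sum:
  assumes S: "\<And>s. s \<in> S \<Longrightarrow> \<theta> \<le> Re s \<and> \<bar>Im s\<bar> \<le> R"
  shows "uniform_limit S (\<lambda>J s. \<Sum>j<J. block_sum j s) (dirichlet_sum coef) sequentially"
proof -
  have "uniform_limit S (\<lambda>J s. \<Sum>j<J. block_sum j s) (\<lambda>s. \<Sum>j. block_sum j s) sequentially"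
  proof (rule Weierstrass_m_test)
    fix j s assume "s \<in> S"
    then have s: "\<theta> \<le> Re s" "\<bar>Im s\<bar> \<le> R" using S by auto
    have "96 * weight j * (1 + \<bar>Im s\<bar>) \<le> 96 * weight j * (1 + R)"
      using s by (intro mult_left_mono) auto
    then show "cmod (block_sum j s) \<le> 96 * weight j * (1 + R)"
      using norm_block_sum_le_uniform[OF s(1), of j] by linarith
  qed (intro summable_mult2 summable_mult summable_weight)
  then show ?thesis
    by (rule uniform_limit_cong'[THEN iffD1, rotated -1]) (use S dirichlet_sum_eq in auto)
qed

lemma block_sum_holomorphic: "block_sum j holomorphic_on A"
  unfolding block_sum_def gterm_def
  by (intro holomorphic_on_sum holomorphic_intros) (auto dest: less_of_mem_block)

lemma dirichlet_sum_holomorphic: "dirichlet_sum coef holomorphic_on right_half_plane \<theta>"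
proof (rule holomorphic_uniform_sequence)
  show "open (right_half_plane \<theta>)"
    unfolding right_half_plane_def by (rule open_halfspace_Re_gt)
  show "(\<lambda>s. \<Sum>j<J. block_sum j s) holomorphic_on right_half_plane \<theta>" for J
    by (intro holomorphic_on_sum block_sum_holomorphic)
  fix s assume s: "s \<in> right_half_plane \<theta>"
  define d where "d = (Re s - \<theta>) / 2"
  have d: "0 < d" using s by (simp add: d_def right_half_plane_def)
  have near: "\<theta> < Re z \<and> \<bar>Im z\<bar> \<le> \<bar>Im s\<bar> + d" if "z \<in> cball s d" for z
  proof -
    have "cmod (s - z) \<le> d" using that by (simp add: dist_norm)
    then have "Re s - Re z \<le> d" "\<bar>Im s - Im z\<bar> \<le> d"
      using abs_Re_le_cmod[of "s - z"] abs_Im_le_cmod[of "s - z"] by auto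
    moreover have "2 * d = Re s - \<theta>" by (simp add: d_def)
    ultimately show ?thesis using d by linarith
  qed
  show "\<exists>d>0. cball s d \<subseteq> right_half_plane \<theta> \<and>
      uniform_limit (cball s d) (\<lambda>J s. \<Sum>j<J. block_sum j s) (dirichlet_sum coef) sequentially"
  proof (intro exI conjI)
    show "cball s d \<subseteq> right_half_plane \<theta>" using near by (auto simp: right_half_plane_def)
    show "uniform_limit (cball s d) (\<lambda>J s. \<Sum>j<J. block_sum j s) (dirichlet_sum coef) sequentially"
      by (rule uniform_limit_block_sum) (use near less_imp_le in blast)
  qed fact
qed

lemma norm_dirichlet_sum_le:
  assumes "\<theta> \<le> Re s"
  shows "cmod (dirichlet_sum coef s) \<le> 192 * (1 + \<bar>Im s\<bar>)"
proof -
  have sums: "(\<lambda>j. 96 * weight j * (1 + \<bar>Im s\<bar>)) sums (96 * 2 * (1 + \<bar>Im s\<bar>))"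
    by (intro sums_mult2 sums_mult weight_sums)
  have "cmod (\<Sum>j. block_sum j s) \<le> (\<Sum>j. 96 * weight j * (1 + \<bar>Im s\<bar>))"
    using norm_block_sum_le_uniform[OF assms] sums by (intro norm_suminf_le) (auto simp: sums_iff)
  then show ?thesis using sums by (simp add: dirichlet_sum_eq[OF assms] sums_iff)
qed

lemma finite_order_dirichlet_sum:
  assumes "\<theta> \<le> \<kappa>"
  shows "finite_order \<kappa> (dirichlet_sum coef)"
  unfolding finite_order_def
proof (intro conjI allI impI)
  show "dirichlet_sum coef holomorphic_on right_half_plane \<kappa>"
    by (rule holomorphic_on_subset[OF dirichlet_sum_holomorphic])
       (use assms in \<open>auto simp: right_half_plane_def\<close>)
  fix e :: real assume "0 < e"
  then have "cmod (dirichlet_sum coef (Complex \<sigma> t)) \<le> 192 * (1 + \<bar>t\<bar>) powr 1" if "\<kappa> + e \<le> \<sigma>" for \<sigma> t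
    using norm_dirichlet_sum_le[of "Complex \<sigma> t"] that assms by simp
  then show "\<exists>A B. \<forall>\<sigma>\<ge>\<kappa> + e. \<forall>t. cmod (dirichlet_sum coef (Complex \<sigma> t)) \<le> B * (1 + \<bar>t\<bar>) powr A"
    by blast
qed

section \<open>Membership in the Hardy space and the two abscissas of convergence\<close>

lemma summable_of_block_sums:
  fixes f :: "nat \<Rightarrow> real"
  assumes nonneg: "\<And>n. 0 \<le> f n" and zero: "\<And>n. (\<And>j. n \<notin> block j) \<Longrightarrow> f n = 0"
    and le: "\<And>j. sum f (block j) \<le> M j" and M: "summable M"
  shows "summable (\<lambda>k. f (Suc k))"
proof -
  have M0: "0 \<le> M j" for j
    using le[of j] sum_nonneg[of "block j" f] nonneg by fastforce
  have "summable f"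
  proof (rule summableI_nonneg_bounded[OF nonneg])
    fix K
    have "sum f {..<K} = (\<Sum>j<K. sum f (block j \<inter> {..<K}))"
      by (rule sum_lessThan_eq_sum_blocks) (rule zero)
    also have "\<dots> \<le> (\<Sum>j<K. M j)"
      by (intro sum_mono order.trans[OF _ le] sum_mono2 nonneg) auto
    also have "\<dots> \<le> suminf M"
      using M M0 by (intro sum_le_suminf) auto
    finally show "sum f {..<K} \<le> suminf M" .
  qed
  then show ?thesis by (rule summable_ignore_initial_segment[of f 1, simplified])
qed

lemma coef_in_H2: "coef \<in> hardy_H2"
  unfolding hardy_H2_def mem_Collect_eq
proof (rule summable_of_block_sums)
  show "(\<Sum>n\<in>block j. (cmod (coef n))\<^sup>2) \<le> weight j" for j
  proof -
    have "(\<Sum>n\<in>block j. (cmod (coef n))\<^sup>2) = (\<Sum>n\<in>block j. (weight j)\<^sup>2 / real (block_start j))"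
      by (intro sum.cong refl) (simp add: norm_coef_block power_mult_distrib powr_power powr_minus field_simps)
    also have "\<dots> = weight j * weight j" by (simp add: power2_eq_square)
    also have "\<dots> \<le> weight j * 1" by (intro mult_left_mono weight_le_1) auto
    finally show ?thesis by simp
  qed
qed (auto intro: summable_weight coef_not_block)

lemma summable_norm_dirichlet_term:
  assumes "1 / 2 \<le> Re s"
  shows "summable (\<lambda>k. norm (dirichlet_term coef s k))"
  unfolding dirichlet_term_eq_gterm
proof (rule summable_of_block_sums)
  show "(\<Sum>n\<in>block j. cmod (gterm s n)) \<le> 2 * weight j" for j
  proof -
    have "real (block_start j) powr (1 / 2 - Re s) \<le> real (block_start j) powr 0"
      using assms block_start_ge[of j] by (intro powr_mono) auto
    then have "2 * weight j * real (block_start j) powr (1 / 2 - Re s) \<le> 2 * weight j * 1"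
      by (intro mult_left_mono) auto
    moreover have "(\<Sum>n\<in>block j. cmod (gterm s n)) \<le> 2 * weight j * real (block_start j) powr (1 / 2 - Re s)"
      using assms by (intro sum_block_norm_le) auto
    ultimately show ?thesis by linarith
  qed
qed (auto intro: summable_mult summable_weight gterm_not_block)

text \<open>
  Over the first wave of a block, about \<open>N / freq j\<close> terms, nothing cancels, and these segments
  of the series have size \<open>weight j * N powr (\<theta> - \<sigma>)\<close>, which is unbounded.
\<close>

lemma not_summable_dirichlet_term:
  assumes "\<sigma> < \<theta>"
  shows "\<not> summable (dirichlet_term coef (of_real \<sigma>))"
proof
  assume "summable (dirichlet_term coef (of_real \<sigma>))"
  then have "summable (gterm (of_real \<sigma>))"
    unfolding dirichlet_term_eq_gterm by (rule summable_Suc_iff[THEN iffD1])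
  then have "convergent (\<lambda>K. \<Sum>n<K. gterm (of_real \<sigma>) n)"
    by (simp add: summable_iff_convergent)
  then obtain C where C: "\<And>K. cmod (\<Sum>n<K. gterm (of_real \<sigma>) n) \<le> C"
    using convergent_imp_Bseq Bseq_def by (metis (no_types, lifting) BseqE)
  have "weight j * real (block_start j) powr (\<theta> - \<sigma>) \<le> 16 * C" for j
  proof -
    let ?N = "block_start j"
    define r where "r = real ?N / freq j"
    define M where "M = nat \<lfloor>r\<rfloor>"
    have "1 \<le> r" using freq_le[of j] freq_pos[of j] by (simp add: r_def)
    then have M: "real M = real_of_int \<lfloor>r\<rfloor>" "1 \<le> real_of_int \<lfloor>r\<rfloor>"
      by (simp_all add: M_def le_floor_iff)
    have M1: "real M \<le> r" and M2: "r / 2 \<le> real M"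
      using M of_int_floor_le[of r] real_of_int_floor_add_one_gt[of r] by linarith+
    have "1 \<le> freq j"
      unfolding freq_def using \<theta>_lt block_start_ge[of j] by (intro ge_one_powr_ge_zero) auto
    then have "real M * 1 \<le> real M * freq j" by (intro mult_left_mono) auto
    also have M3: "real M * freq j \<le> real ?N" using M1 freq_pos[of j] by (simp add: r_def field_simps)
    finally have MN: "M \<le> ?N" by simp
    have "weight j * real ?N powr (- (1 / 2) - \<sigma>) * real M / 4
        \<le> cmod (\<Sum>n=?N..<?N + M. gterm (of_real \<sigma>) n)"
      using norm_initial_segment_ge[of "of_real \<sigma>" M j] MN M3 assms \<theta>_lt freq_pos[of j]
      by (simp add: field_simps)
    also have "(\<Sum>n=?N..<?N + M. gterm (of_real \<sigma>) n)
        = (\<Sum>n<?N + M. gterm (of_real \<sigma>) n) - (\<Sum>n<?N. gterm (of_real \<sigma>) n)"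
      by (simp add: lessThan_atLeast0 sum_diff_nat_ivl)
    also have "cmod \<dots> \<le> C + C"
      by (rule order.trans[OF norm_triangle_ineq4 add_mono[OF C C]])
    finally have "weight j * real ?N powr (- (1 / 2) - \<sigma>) * real M \<le> 8 * C" by simp
    moreover have "weight j * real ?N powr (- (1 / 2) - \<sigma>) * (r / 2)
        \<le> weight j * real ?N powr (- (1 / 2) - \<sigma>) * real M"
      using M2 by (intro mult_left_mono) auto
    ultimately have A: "2 * (weight j * real ?N powr (- (1 / 2) - \<sigma>) * (r / 2)) \<le> 16 * C" by linarith
    have B: "2 * (weight j * real ?N powr (- (1 / 2) - \<sigma>) * (r / 2))
        = weight j * (real ?N powr (- (1 / 2) - \<sigma>) * r)" by simp
    have C: "real ?N powr (- (1 / 2) - \<sigma>) * r = real ?N powr (\<theta> - \<sigma>)"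
    proof -
      have "real ?N powr (- (1 / 2) - \<sigma>) * (real ?N powr 1 / freq j) = real ?N powr (\<theta> - \<sigma>)"
        unfolding freq_def powr_diff[symmetric] powr_add[symmetric] by (simp add: algebra_simps)
      then show ?thesis by (simp add: r_def)
    qed
    show ?thesis using A unfolding B C .
  qed
  moreover have "\<forall>\<^sub>F j in sequentially. 16 * C + 1 \<le> weight j * real (block_start j) powr (\<theta> - \<sigma>)"
    using weight_mult_powr_at_top[of "\<theta> - \<sigma>"] assms by (simp add: filterlim_at_top)
  ultimately show False
    by (metis (no_types, lifting) add_le_same_cancel1 eventually_sequentially not_one_le_zero order.refl order.trans)
qed

text \<open>
  The moduli of the terms do not depend on the height, so the sum of the moduli over a block is at
  least the value of the block at its peak.
\<close>

lemma not_summable_norm_dirichlet_term: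
  assumes "\<sigma> < 1 / 2"
  shows "\<not> summable (\<lambda>k. norm (dirichlet_term coef (of_real \<sigma>) k))"
proof
  assume "summable (\<lambda>k. norm (dirichlet_term coef (of_real \<sigma>) k))"
  then have S: "summable (\<lambda>n. cmod (gterm (of_real \<sigma>) n))"
    unfolding dirichlet_term_eq_gterm by (rule summable_Suc_iff[THEN iffD1])
  define C where "C = (\<Sum>n. cmod (gterm (of_real \<sigma>) n))"
  have "weight j * real (block_start j) powr (1 / 2 - \<sigma>) \<le> 4 * C" for j
  proof -
    have "weight j * real (block_start j) powr (1 / 2 - \<sigma>) / 4
        \<le> cmod (block_sum j (Complex \<sigma> (freq j)))"
      using norm_block_sum_ge[of "Complex \<sigma> (freq j)" j] assms by simp
    also have "\<dots> \<le> (\<Sum>n\<in>block j. cmod (gterm (Complex \<sigma> (freq j)) n))"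
      unfolding block_sum_def by (rule norm_sum)
    also have "\<dots> = (\<Sum>n\<in>block j. cmod (gterm (of_real \<sigma>) n))"
      by (intro sum.cong refl) (simp add: norm_gterm_block)
    also have "\<dots> \<le> C"
      unfolding C_def by (intro sum_le_suminf S) auto
    finally show ?thesis by simp
  qed
  moreover have "\<forall>\<^sub>F j in sequentially. 4 * C + 1 \<le> weight j * real (block_start j) powr (1 / 2 - \<sigma>)"
    using weight_mult_powr_at_top[of "1 / 2 - \<sigma>"] assms by (simp add: filterlim_at_top)
  ultimately show False
    by (metis (no_types, lifting) add_le_same_cancel1 eventually_sequentially not_one_le_zero order.refl order.trans)
qed

lemma abscissa_conv_coef: "abscissa_conv coef = ereal \<theta>"
  unfolding abscissa_conv_def
proof (rule antisym)
  show "Inf {ereal \<kappa> |\<kappa>. \<forall>s\<in>right_half_plane \<kappa>. summable (dirichlet_term coef s)} \<le> ereal \<theta>"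
    using sums_summable[OF dirichlet_term_sums] by (intro Inf_lower) (auto simp: right_half_plane_def)
  show "ereal \<theta> \<le> Inf {ereal \<kappa> |\<kappa>. \<forall>s\<in>right_half_plane \<kappa>. summable (dirichlet_term coef s)}"
  proof (rule Inf_greatest)
    fix x assume "x \<in> {ereal \<kappa> |\<kappa>. \<forall>s\<in>right_half_plane \<kappa>. summable (dirichlet_term coef s)}"
    then obtain \<kappa> where \<kappa>: "x = ereal \<kappa>" "\<And>s. \<kappa> < Re s \<Longrightarrow> summable (dirichlet_term coef s)"
      by (auto simp: right_half_plane_def)
    have "\<theta> \<le> \<kappa>"
    proof (rule ccontr)
      assume "\<not> \<theta> \<le> \<kappa>"
      then show False
        using \<kappa>(2)[of "of_real ((\<kappa> + \<theta>) / 2)"] not_summable_dirichlet_term[of "(\<kappa> + \<theta>) / 2"] by simp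
    qed
    then show "ereal \<theta> \<le> x" using \<kappa> by simp
  qed
qed

lemma abscissa_abs_conv_coef: "abscissa_abs_conv coef = ereal (1 / 2)"
  unfolding abscissa_abs_conv_def
proof (rule antisym)
  show "Inf {ereal \<kappa> |\<kappa>. \<forall>s\<in>right_half_plane \<kappa>. summable (\<lambda>k. norm (dirichlet_term coef s k))} \<le> ereal (1 / 2)"
    using summable_norm_dirichlet_term
    by (intro Inf_lower CollectI exI[of _ "1 / 2"]) (auto simp: right_half_plane_def)
  show "ereal (1 / 2) \<le> Inf {ereal \<kappa> |\<kappa>. \<forall>s\<in>right_half_plane \<kappa>. summable (\<lambda>k. norm (dirichlet_term coef s k))}"
  proof (rule Inf_greatest)
    fix x assume "x \<in> {ereal \<kappa> |\<kappa>. \<forall>s\<in>right_half_plane \<kappa>. summable (\<lambda>k. norm (dirichlet_term coef s k))}"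
    then obtain \<kappa> where \<kappa>: "x = ereal \<kappa>" "\<And>s. \<kappa> < Re s \<Longrightarrow> summable (\<lambda>k. norm (dirichlet_term coef s k))"
      by (auto simp: right_half_plane_def)
    have "1 / 2 \<le> \<kappa>"
    proof (rule ccontr)
      assume "\<not> 1 / 2 \<le> \<kappa>"
      then show False
        using \<kappa>(2)[of "of_real ((\<kappa> + 1 / 2) / 2)"] not_summable_norm_dirichlet_term[of "(\<kappa> + 1 / 2) / 2"] by simp
    qed
    then show "ereal (1 / 2) \<le> x" using \<kappa> by simp
  qed
qed

section \<open>Peaks at the frequencies\<close>

lemma continuous_on_vertical_line:
  assumes "\<theta> < \<sigma>"
  shows "continuous_on UNIV (\<lambda>t. dirichlet_sum coef (Complex \<sigma> t))"
proof (rule continuous_on_compose2[where f = "Complex \<sigma>" and g = "dirichlet_sum coef"])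
  show "continuous_on (right_half_plane \<theta>) (dirichlet_sum coef)"
    by (rule holomorphic_on_imp_continuous_on[OF dirichlet_sum_holomorphic])
  show "continuous_on UNIV (Complex \<sigma>)"
    unfolding Complex_eq by (intro continuous_intros)
qed (use assms in \<open>auto simp: right_half_plane_def\<close>)

lemma continuous_on_block_sum: "continuous_on UNIV (\<lambda>t. block_sum j (Complex \<sigma> t))"
proof (rule continuous_on_compose2[where f = "Complex \<sigma>" and g = "block_sum j"])
  show "continuous_on UNIV (block_sum j)"
    by (rule holomorphic_on_imp_continuous_on[OF block_sum_holomorphic])
  show "continuous_on UNIV (Complex \<sigma>)"
    unfolding Complex_eq by (intro continuous_intros)
qed auto

lemma freq_mono: "i \<le> j \<Longrightarrow> freq i \<le> freq j"
  unfolding freq_def using block_start_mono[of i j] \<theta>_lt by (intro powr_mono2) auto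

lemma freq_Suc: "freq (Suc j) = (freq j)\<^sup>2"
  unfolding freq_def block_start_Suc by (simp add: power2_eq_square powr_mult)

lemma powr_at_top:
  assumes "0 < \<beta>"
  shows "filterlim (\<lambda>j. real (block_start j) powr \<beta>) at_top sequentially"
proof (rule filterlim_at_top_mono[OF weight_mult_powr_at_top[OF assms]])
  have "weight j * real (block_start j) powr \<beta> \<le> 1 * real (block_start j) powr \<beta>" for j
    by (intro mult_right_mono weight_le_1) auto
  then show "\<forall>\<^sub>F j in sequentially. weight j * real (block_start j) powr \<beta> \<le> real (block_start j) powr \<beta>"
    by simp
qed

lemma freq_at_top: "filterlim freq at_top sequentially"
  unfolding freq_def using \<theta>_lt by (intro powr_at_top) auto

text \<open>
  Later blocks have not reached their peak and are bounded; earlier blocks are bounded by the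
  trivial estimate, which by \<open>block_start_Suc\<close> is only the square root \<open>X\<close> of the size of the
  current one. The hypothesis \<open>\<sigma> < 1 / 2\<close> is what makes the difference between \<open>X\<close> and \<open>X * X\<close>
  a positive power.
\<close>

lemma block_dominates_near_freq:
  assumes \<sigma>: "\<theta> < \<sigma>" "\<sigma> < 1 / 2"
  shows "\<forall>\<^sub>F k in sequentially. \<forall>t. \<bar>t - freq k\<bar> \<le> 1 \<longrightarrow>
    weight k * real (block_start k) powr (1 / 2 - \<sigma>) / 8 \<le> cmod (dirichlet_sum coef (Complex \<sigma> t))"
proof -
  define \<beta> where "\<beta> = 1 / 2 - \<sigma>"
  have \<beta>: "0 < \<beta>" using \<sigma> by (simp add: \<beta>_def)
  \<comment> \<open>The other blocks total at most \<open>192 * X\<close>; with \<open>1536 = 8 * 192\<close> they cost at most half of the peak.\<close>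
  have 1: "\<forall>\<^sub>F k in sequentially. 1536 \<le> weight k * real (block_start k) powr (\<beta> / 2)"
    using weight_mult_powr_at_top[of "\<beta> / 2"] \<beta> by (simp add: filterlim_at_top)
  have 2: "\<forall>\<^sub>F k in sequentially. 3 \<le> freq k"
    using freq_at_top by (simp add: filterlim_at_top)
  from 1 2 show ?thesis
  proof eventually_elim
    case (elim k)
    define X where "X = real (block_start k) powr (\<beta> / 2)"
    have X1: "1 \<le> X"
      unfolding X_def using \<beta> block_start_ge[of k] by (intro ge_one_powr_ge_zero) auto
    have XX: "real (block_start k) powr \<beta> = X * X"
      unfolding X_def powr_add[symmetric] by simp
    show ?case
    proof (intro allI impI)
      fix t assume t: "\<bar>t - freq k\<bar> \<le> 1"
      let ?s = "Complex \<sigma> t"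
      have s: "\<theta> \<le> Re ?s" using \<sigma> by simp
      define r where "r j = (if j = k then 0 else block_sum j ?s)" for j
      have r_le: "cmod (r j) \<le> 96 * weight j * X" for j
      proof -
        consider "j = k" | "j < k" | "k < j" by linarith
        then show ?thesis
        proof cases
          case 1
          then show ?thesis using X1 by (simp add: r_def)
        next
          case 2
          then obtain k' where k': "k = Suc k'" "j \<le> k'" by (cases k) auto
          have "real (block_start j) powr \<beta> \<le> real (block_start k') powr \<beta>"
            using block_start_mono[OF k'(2)] \<beta> by (intro powr_mono2) auto
          also have "\<dots> = X"
          proof -
            have "X = real (block_start k') powr (\<beta> / 2) * real (block_start k') powr (\<beta> / 2)"
              unfolding X_def k'(1) block_start_Suc by (simp add: power2_eq_square powr_mult)
            then show ?thesis unfolding powr_add[symmetric] by simp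
          qed
          finally have 3: "2 * weight j * real (block_start j) powr \<beta> \<le> 2 * weight j * X"
            by (intro mult_left_mono) auto
          have 4: "cmod (block_sum j ?s) \<le> 2 * weight j * real (block_start j) powr \<beta>"
            unfolding block_sum_def \<beta>_def using norm_partial_block_le[of ?s "block j" j] \<sigma> \<theta>_gt by simp
          have 5: "2 * weight j * X \<le> 96 * weight j * X"
            using X1 by (intro mult_right_mono) auto
          show ?thesis using 2 order.trans[OF 4 order.trans[OF 3 5]] by (simp add: r_def)
        next
          case 3
          have "\<bar>t\<bar> \<le> freq k + 1"
            using t elim(2) unfolding abs_le_iff by linarith
          then have "2 * \<bar>t\<bar> \<le> 2 * (freq k + 1)" by simp
          also have "\<dots> \<le> freq k * freq k"
          proof -
            have "3 * freq k \<le> freq k * freq k" using elim by (intro mult_right_mono) auto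
            moreover have "2 * (freq k + 1) \<le> 3 * freq k" using elim(2) by simp
            ultimately show ?thesis by (rule order.trans[rotated])
          qed
          also have "\<dots> \<le> freq j"
            using freq_mono[of "Suc k" j] 3 by (simp add: freq_Suc power2_eq_square)
          finally have 4: "cmod (block_sum j ?s) \<le> 96 * weight j * real (block_start j) powr (\<theta> - \<sigma>)"
            unfolding block_sum_def block_def
            using norm_partial_block_le_small_height[of ?s j "block_start j" "2 * block_start j"] \<sigma> \<theta>_gt by simp
          have "real (block_start j) powr (\<theta> - \<sigma>) \<le> real (block_start j) powr 0"
            using \<sigma> block_start_ge[of j] by (intro powr_mono) auto
          then have 5: "96 * weight j * real (block_start j) powr (\<theta> - \<sigma>) \<le> 96 * weight j * X"
            using X1 by (intro mult_left_mono) auto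
          show ?thesis using 3 order.trans[OF 4 5] by (simp add: r_def)
        qed
      qed
      have sums: "(\<lambda>j. 96 * weight j * X) sums (96 * 2 * X)"
        by (intro sums_mult2 sums_mult weight_sums)
      have r_sums: "r sums (dirichlet_sum coef ?s - block_sum k ?s)"
      proof -
        have "(\<lambda>j. block_sum j ?s) sums dirichlet_sum coef ?s"
          unfolding dirichlet_sum_eq[OF s]
          by (rule summable_sums[OF summable_norm_cancel[OF summable_norm_block_sum[OF s]]])
        from sums_diff[OF this sums_single[of k "\<lambda>j. block_sum j ?s"]]
        show ?thesis by (rule sums_cong[THEN iffD1, rotated]) (simp add: r_def)
      qed
      have "cmod (suminf r) \<le> (\<Sum>j. 96 * weight j * X)"
        using r_le sums by (intro norm_suminf_le) (auto simp: sums_iff)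
      then have small: "cmod (dirichlet_sum coef ?s - block_sum k ?s) \<le> 192 * X"
        using sums r_sums by (simp add: sums_iff)
      have "weight k * real (block_start k) powr \<beta> / 4 \<le> cmod (block_sum k ?s)"
        using norm_block_sum_ge[of ?s k] \<sigma> t by (simp add: \<beta>_def abs_minus_commute)
      moreover have "cmod (block_sum k ?s) \<le> cmod (dirichlet_sum coef ?s) + cmod (dirichlet_sum coef ?s - block_sum k ?s)"
        using norm_triangle_ineq4[of "dirichlet_sum coef ?s" "dirichlet_sum coef ?s - block_sum k ?s"] by simp
      moreover have "1536 * X \<le> weight k * X * X"
        using elim(1) X1 unfolding X_def[symmetric] by (intro mult_right_mono) auto
      ultimately show "weight k * real (block_start k) powr (1 / 2 - \<sigma>) / 8 \<le> cmod (dirichlet_sum coef ?s)"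
        using small unfolding \<beta>_def[symmetric] XX by (simp add: mult.assoc)
    qed
  qed
qed

section \<open>The mean value formula\<close>

text \<open>
  If \<open>2 T \<le> freq j\<close>, the segment does not reach the peak and the supremum bound suffices. Otherwise
  the off-diagonal terms contribute at most \<open>N powr (1 - 2 * \<sigma>) / freq j\<close>, up to weights, and
  this is bounded exactly when \<open>\<sigma> \<ge> (1 + 2 * \<theta>) / 4\<close>.
\<close>

lemma rms_block_sum_le:
  assumes \<sigma>: "(1 + 2 * \<theta>) / 4 \<le> \<sigma>" and T: "1 \<le> T"
  shows "rms T (\<lambda>t. block_sum j (Complex \<sigma> t)) \<le> 96 * sqrt (weight j)"
proof (cases "2 * T \<le> freq j")
  case True
  have \<sigma>\<theta>: "\<theta> \<le> \<sigma>" using \<sigma> \<theta>_lt by (simp add: field_simps)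
  have w: "weight j \<le> sqrt (weight j)"
    using weight_le_1[of j] by (intro real_le_rsqrt) (simp add: power2_eq_square mult_left_le)
  show ?thesis
  proof (rule rms_le)
    fix t assume t: "\<bar>t\<bar> \<le> T"
    have "real (block_start j) powr (\<theta> - \<sigma>) \<le> real (block_start j) powr 0"
      using \<sigma>\<theta> block_start_ge[of j] by (intro powr_mono) auto
    then have "96 * weight j * real (block_start j) powr (\<theta> - \<sigma>) \<le> 96 * weight j * 1"
      by (intro mult_left_mono) auto
    moreover have "cmod (block_sum j (Complex \<sigma> t)) \<le> 96 * weight j * real (block_start j) powr (\<theta> - \<sigma>)"
      unfolding block_sum_def block_def
      using norm_partial_block_le_small_height[of "Complex \<sigma> t" j "block_start j" "2 * block_start j"]
        \<sigma>\<theta> \<theta>_gt True t by simp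
    ultimately show "cmod (block_sum j (Complex \<sigma> t)) \<le> 96 * sqrt (weight j)" using w by linarith
  qed (use T continuous_on_block_sum in auto)
next
  case False
  let ?N = "real (block_start j)"
  have \<sigma>0: "0 < \<sigma>" using \<sigma> \<theta>_gt by (simp add: field_simps)
  define c where "c n = coef n * of_real (real n powr - \<sigma>)" for n
  define q where "q = weight j * ?N powr - (1 / 2) * ?N powr - \<sigma>"
  have q: "cmod (c n) \<le> q" if "n \<in> block j" for n
  proof -
    have "real n powr - \<sigma> \<le> ?N powr - \<sigma>"
      using that \<sigma>0 by (intro powr_mono2') (auto simp: block_def)
    then show ?thesis
      using that unfolding c_def q_def by (simp add: norm_mult norm_coef_block mult_left_mono)
  qed
  have eq: "block_sum j (Complex \<sigma> t) = (\<Sum>n\<in>block j. c n * cis (- t * ln (real n)))" for t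
    unfolding block_sum_def gterm_def c_def
    by (intro sum.cong refl) (auto simp: of_nat_powr_eq_cis mult.assoc dest: less_of_mem_block)
  have q2: "?N * q\<^sup>2 = (weight j)\<^sup>2 * ?N powr (- 2 * \<sigma>)"
  proof -
    have "q\<^sup>2 = (weight j)\<^sup>2 * (?N powr - 1 * ?N powr (- 2 * \<sigma>))"
      unfolding q_def power_mult_distrib by (simp add: powr_power)
    then show ?thesis by (simp add: powr_minus field_simps)
  qed
  have le1: "?N * q\<^sup>2 \<le> weight j"
  proof -
    have "?N powr (- 2 * \<sigma>) \<le> ?N powr 0"
      using \<sigma>0 block_start_ge[of j] by (intro powr_mono) auto
    then have "(weight j)\<^sup>2 * ?N powr (- 2 * \<sigma>) \<le> (weight j)\<^sup>2 * 1"
      by (intro mult_left_mono) auto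
    also have "\<dots> \<le> weight j"
      using weight_le_1[of j] by (simp add: power2_eq_square mult_left_le)
    finally show ?thesis using q2 by simp
  qed
  have le2: "?N\<^sup>2 * q\<^sup>2 / weight j \<le> 2 * T * weight j"
  proof -
    have "?N\<^sup>2 * q\<^sup>2 / weight j = ?N * (?N * q\<^sup>2) / weight j"
      by (simp add: power2_eq_square)
    also have "\<dots> = weight j * (?N powr 1 * ?N powr (- 2 * \<sigma>))"
      unfolding q2 by (simp add: power2_eq_square)
    also have "\<dots> = weight j * ?N powr (1 - 2 * \<sigma>)"
      unfolding powr_add[symmetric] by simp
    also have "\<dots> \<le> weight j * freq j"
      unfolding freq_def using \<sigma> block_start_ge[of j] by (intro mult_left_mono powr_mono) (auto simp: field_simps)
    also have "\<dots> \<le> weight j * (2 * T)"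
      using False by (intro mult_left_mono) auto
    finally show ?thesis by (simp add: mult_ac)
  qed
  have "integral {-T..T} (\<lambda>t. (cmod (block_sum j (Complex \<sigma> t)))\<^sup>2)
      \<le> 2 * T * (?N * q\<^sup>2) + 16 * ?N\<^sup>2 * q\<^sup>2 / weight j"
    unfolding eq using T q by (intro integral_block_polynomial_le) auto
  also have "\<dots> \<le> 2 * T * weight j + 16 * (2 * T * weight j)"
    using le1 le2 T by (intro add_mono mult_left_mono) auto
  finally have "(rms T (\<lambda>t. block_sum j (Complex \<sigma> t)))\<^sup>2 \<le> 17 * weight j"
    using T by (simp add: rms_square field_simps)
  also have "\<dots> \<le> (96 * sqrt (weight j))\<^sup>2"
    by (simp add: power_mult_distrib)
  finally show ?thesis
    by (rule power2_le_imp_le) simp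
qed

lemma summable_mean_series:
  assumes "0 \<le> \<sigma>"
  shows "summable (\<lambda>k. (cmod (coef (Suc k)))\<^sup>2 * real (Suc k) powr (- 2 * \<sigma>))"
proof (rule summable_comparison_test')
  show "summable (\<lambda>k. (cmod (coef (Suc k)))\<^sup>2)"
    using coef_in_H2 by (simp add: hardy_H2_def)
  fix k :: nat
  have "real (Suc k) powr (- 2 * \<sigma>) \<le> real (Suc k) powr 0"
    using assms by (intro powr_mono) auto
  then have "(cmod (coef (Suc k)))\<^sup>2 * real (Suc k) powr (- 2 * \<sigma>) \<le> (cmod (coef (Suc k)))\<^sup>2 * 1"
    by (intro mult_left_mono) (auto simp del: of_nat_Suc)
  then show "norm ((cmod (coef (Suc k)))\<^sup>2 * real (Suc k) powr (- 2 * \<sigma>)) \<le> (cmod (coef (Suc k)))\<^sup>2"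
    by simp
qed

lemma tendsto_rms_dirichlet_sum:
  assumes \<sigma>: "(1 + 2 * \<theta>) / 4 \<le> \<sigma>"
  shows "((\<lambda>T. rms T (\<lambda>t. dirichlet_sum coef (Complex \<sigma> t)))
    \<longlongrightarrow> sqrt (\<Sum>k. (cmod (coef (Suc k)))\<^sup>2 * real (Suc k) powr (- 2 * \<sigma>))) at_top"
proof -
  have \<sigma>0: "0 < \<sigma>" and \<sigma>\<theta>: "\<theta> < \<sigma>"
    using \<sigma> \<theta>_gt \<theta>_lt by (simp_all add: field_simps)
  define f where "f n = (cmod (coef n))\<^sup>2 * real n powr (- 2 * \<sigma>)" for n
  show ?thesis
  proof (rule tendsto_rms_suminf)
    show "rms T (\<lambda>t. block_sum j (Complex \<sigma> t)) \<le> 96 * sqrt (weight j)" if "1 \<le> T" for j T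
      by (rule rms_block_sum_le[OF \<sigma> that])
    show "summable (\<lambda>j. 96 * sqrt (weight j))"
      unfolding weight_def real_sqrt_power
      by (intro summable_mult summable_geometric) (simp add: real_sqrt_divide)
    show "uniform_limit {-T..T} (\<lambda>J t. \<Sum>j<J. block_sum j (Complex \<sigma> t))
        (\<lambda>t. dirichlet_sum coef (Complex \<sigma> t)) sequentially" for T
    proof -
      have "uniform_limit (Complex \<sigma> ` {-T..T}) (\<lambda>J s. \<Sum>j<J. block_sum j s) (dirichlet_sum coef) sequentially"
        using \<sigma>\<theta> by (intro uniform_limit_block_sum[where R = T]) auto
      then show ?thesis by (simp add: uniform_limit_iff)
    qed
    show "((\<lambda>T. rms T (\<lambda>t. \<Sum>j<J. block_sum j (Complex \<sigma> t)))
        \<longlongrightarrow> sqrt (\<Sum>k<block_start J - 1. f (Suc k))) at_top" for J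
    proof -
      \<comment> \<open>The integers of the first \<open>J\<close> blocks lie below \<open>block_start J\<close>, and the coefficients at the other integers there vanish.\<close>
      define A where "A = (\<Union>j<J. block j)"
      define c where "c n = coef n * of_real (real n powr - \<sigma>)" for n
      have A: "finite A" "0 \<notin> A" "inj_on (\<lambda>n. ln (real n)) A"
        unfolding A_def by (auto simp: inj_on_def dest!: less_of_mem_block)
      have "(\<Sum>j<J. block_sum j (Complex \<sigma> t)) = (\<Sum>n\<in>A. c n * cis (- t * ln (real n)))" for t
      proof -
        have "(\<Sum>j<J. block_sum j (Complex \<sigma> t)) = (\<Sum>n\<in>A. gterm (Complex \<sigma> t) n)"
          unfolding A_def block_sum_def by (subst sum.UNION_disjoint) (auto dest: block_disjoint)
        also have "\<dots> = (\<Sum>n\<in>A. c n * cis (- t * ln (real n)))"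
        proof (intro sum.cong refl)
          fix n assume "n \<in> A"
          then have "0 < n" using A(2) by (cases n) auto
          then show "gterm (Complex \<sigma> t) n = c n * cis (- t * ln (real n))"
            by (simp add: gterm_def c_def of_nat_powr_eq_cis mult.assoc)
        qed
        finally show ?thesis .
      qed
      moreover have "(\<Sum>n\<in>A. (cmod (c n))\<^sup>2) = (\<Sum>k<block_start J - 1. f (Suc k))"
      proof -
        have "(\<Sum>n\<in>A. (cmod (c n))\<^sup>2) = (\<Sum>n\<in>A. f n)"
        proof (intro sum.cong refl)
          fix n assume "n \<in> A"
          then have "n \<noteq> 0" using A(2) by (cases n) auto
          then show "(cmod (c n))\<^sup>2 = f n"
            by (simp add: c_def f_def norm_mult power_mult_distrib powr_power)
        qed
        also have "\<dots> = (\<Sum>n\<in>{1..<block_start J}. f n)"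
        proof (rule sum.mono_neutral_left)
          show "A \<subseteq> {1..<block_start J}"
            unfolding A_def using two_block_start_le by (fastforce simp: block_def dest: less_of_mem_block)
          show "\<forall>n\<in>{1..<block_start J} - A. f n = 0"
          proof
            fix n assume n: "n \<in> {1..<block_start J} - A"
            have "n \<notin> block j" for j
              using n block_start_mono[of J j] by (cases "j < J") (auto simp: A_def block_def)
            then show "f n = 0" by (simp add: f_def coef_not_block)
          qed
        qed simp
        also have "\<dots> = (\<Sum>k<block_start J - 1. f (Suc k))"
          by (rule sum.reindex_bij_witness[of _ Suc "\<lambda>n. n - 1"]) auto
        finally show ?thesis .
      qed
      ultimately show ?thesis
        using tendsto_rms_dirichlet_polynomial[OF A(1,3), of c] by simp
    qed
    show "(\<lambda>J. sqrt (\<Sum>k<block_start J - 1. f (Suc k)))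
        \<longlonglongrightarrow> sqrt (\<Sum>k. (cmod (coef (Suc k)))\<^sup>2 * real (Suc k) powr (- 2 * \<sigma>))"
    proof (rule tendsto_real_sqrt)
      have "summable (\<lambda>k. f (Suc k))"
        unfolding f_def using \<sigma>0 by (intro summable_mean_series) auto
      then have "(\<lambda>K. \<Sum>k<K. f (Suc k)) \<longlonglongrightarrow> (\<Sum>k. f (Suc k))"
        by (rule summable_LIMSEQ)
      moreover have "filterlim (\<lambda>J. block_start J - 1) sequentially sequentially"
        unfolding filterlim_at_top eventually_sequentially
      proof (intro allI exI impI)
        fix Z J :: nat assume "Z \<le> J"
        then show "Z \<le> block_start J - 1" using less_block_start[of J] by linarith
      qed
      ultimately have "(\<lambda>J. \<Sum>k<block_start J - 1. f (Suc k)) \<longlonglongrightarrow> (\<Sum>k. f (Suc k))"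
        by (rule filterlim_compose)
      then show "(\<lambda>J. \<Sum>k<block_start J - 1. f (Suc k))
          \<longlonglongrightarrow> (\<Sum>k. (cmod (coef (Suc k)))\<^sup>2 * real (Suc k) powr (- 2 * \<sigma>))"
        by (simp add: f_def)
    qed
  qed (use \<sigma>\<theta> continuous_on_block_sum continuous_on_vertical_line in auto)
qed

lemma mean_value_formula_dirichlet_sum:
  assumes \<sigma>: "(1 + 2 * \<theta>) / 4 \<le> \<sigma>"
  shows "mean_value_formula coef (dirichlet_sum coef) \<sigma>"
proof -
  have \<sigma>0: "0 < \<sigma>" using \<sigma> \<theta>_gt by (simp add: field_simps)
  define D where "D = (\<Sum>k. (cmod (coef (Suc k)))\<^sup>2 * real (Suc k) powr (- 2 * \<sigma>))"
  have summ: "summable (\<lambda>k. (cmod (coef (Suc k)))\<^sup>2 * real (Suc k) powr (- 2 * \<sigma>))"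
    using \<sigma>0 by (intro summable_mean_series) auto
  have D0: "0 \<le> D" unfolding D_def by (intro suminf_nonneg summ) auto
  have "((\<lambda>T. (rms T (\<lambda>t. dirichlet_sum coef (Complex \<sigma> t)))\<^sup>2) \<longlongrightarrow> (sqrt D)\<^sup>2) at_top"
    unfolding D_def by (intro tendsto_power tendsto_rms_dirichlet_sum \<sigma>)
  then have "((\<lambda>T. 1 / (2 * T) * integral {-T..T} (\<lambda>t. (cmod (dirichlet_sum coef (Complex \<sigma> t)))\<^sup>2))
      \<longlongrightarrow> (sqrt D)\<^sup>2) at_top"
    by (rule Lim_transform_eventually)
       (use eventually_gt_at_top[of 0] in eventually_elim, rule rms_square)
  then have "((\<lambda>T. 1 / (2 * T) * integral {-T..T} (\<lambda>t. (cmod (dirichlet_sum coef (Complex \<sigma> t)))\<^sup>2))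
      \<longlongrightarrow> D) at_top"
    using D0 by simp
  with summ show ?thesis unfolding mean_value_formula_def D_def by blast
qed

text \<open>
  A segment of length \<open>1\<close> at the \<open>k\<close>-th peak alone contributes about
  \<open>N powr (1 - 2 * \<sigma>) / freq k\<close> to the mean square over \<open>[-T, T]\<close> with \<open>T = freq k + 1\<close>, and
  below the critical line this is unbounded.
\<close>

lemma not_tendsto_mean:
  assumes \<sigma>: "\<theta> < \<sigma>" "\<sigma> < (1 + 2 * \<theta>) / 4"
  shows "\<not> ((\<lambda>T. 1 / (2 * T) * integral {-T..T} (\<lambda>t. (cmod (dirichlet_sum coef (Complex \<sigma> t)))\<^sup>2)) \<longlongrightarrow> D) at_top"
proof
  let ?q = "\<lambda>t. (cmod (dirichlet_sum coef (Complex \<sigma> t)))\<^sup>2"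
  let ?N = "\<lambda>k. real (block_start k)"
  assume lim: "((\<lambda>T. 1 / (2 * T) * integral {-T..T} ?q) \<longlongrightarrow> D) at_top"
  have \<sigma>2: "\<sigma> < 1 / 2" using \<sigma> \<theta>_lt by (simp add: field_simps)
  define \<gamma> where "\<gamma> = (1 + 2 * \<theta>) / 4 - \<sigma>"
  have \<gamma>: "0 < \<gamma>" using \<sigma> by (simp add: \<gamma>_def)
  have int: "?q integrable_on {a..b}" for a b
    by (rule integrable_norm_square[OF continuous_on_vertical_line[OF \<sigma>(1)]])
  have "filterlim (\<lambda>k. freq k + 1) at_top sequentially"
    using filterlim_tendsto_add_at_top[OF tendsto_const freq_at_top, of 1] by (simp add: add.commute)
  from filterlim_compose[OF lim this]
  have "(\<lambda>k. 1 / (2 * (freq k + 1)) * integral {-(freq k + 1)..freq k + 1} ?q) \<longlonglongrightarrow> D" .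
  from order_tendstoD(2)[OF this, of "D + 1"]
  have "\<forall>\<^sub>F k in sequentially. 1 / (2 * (freq k + 1)) * integral {-(freq k + 1)..freq k + 1} ?q < D + 1"
    by simp
  moreover have "\<forall>\<^sub>F k in sequentially. 1 \<le> freq k"
    using freq_at_top by (simp add: filterlim_at_top)
  \<comment> \<open>The factor \<open>256\<close> is \<open>64\<close> from the square of \<open>1 / 8\<close> in \<open>y\<close> times \<open>4\<close> from \<open>2 * (freq k + 1) \<le> 4 * freq k\<close>.\<close>
  moreover have "\<forall>\<^sub>F k in sequentially. max 1 (256 * (D + 1)) \<le> weight k * ?N k powr \<gamma>"
    using weight_mult_powr_at_top[OF \<gamma>] unfolding filterlim_at_top by blast
  moreover note block_dominates_near_freq[OF \<sigma>(1) \<sigma>2]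
  ultimately have "\<forall>\<^sub>F k in sequentially. False"
  proof eventually_elim
    case (elim k)
    define y where "y = weight k * ?N k powr (1 / 2 - \<sigma>) / 8"
    define z where "z = weight k * ?N k powr \<gamma>"
    have y0: "0 \<le> y" by (simp add: y_def)
    have "y\<^sup>2 = integral {freq k..freq k + 1} (\<lambda>_. y\<^sup>2)" by simp
    also have "\<dots> \<le> integral {freq k..freq k + 1} ?q"
    proof (rule integral_le)
      fix t assume "t \<in> {freq k..freq k + 1}"
      then have "y \<le> cmod (dirichlet_sum coef (Complex \<sigma> t))"
        using elim(4) by (auto simp: y_def)
      then show "y\<^sup>2 \<le> ?q t" using y0 by (rule power_mono)
    qed (use int in auto)
    also have "\<dots> \<le> integral {-(freq k + 1)..freq k + 1} ?q"
      using elim(2) by (intro integral_subset_le int) auto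
    finally have 1: "y\<^sup>2 \<le> integral {-(freq k + 1)..freq k + 1} ?q" .
    have "(?N k powr (1 / 2 - \<sigma>))\<^sup>2 = freq k * (?N k powr \<gamma>)\<^sup>2"
    proof -
      have "(1 / 2 - \<sigma>) + (1 / 2 - \<sigma>) = (1 / 2 - \<theta>) + (\<gamma> + \<gamma>)" by (simp add: \<gamma>_def field_simps)
      then show ?thesis unfolding freq_def power2_eq_square powr_add[symmetric] by (rule arg_cong)
    qed
    then have y2: "y\<^sup>2 = freq k * z\<^sup>2 / 64"
      by (simp add: y_def z_def power_mult_distrib power_divide)
    have z: "1 \<le> z" "256 * (D + 1) \<le> z" using elim(3) by (simp_all add: z_def)
    have "z * 1 \<le> z * z" using z by (intro mult_left_mono) auto
    then have "256 * (D + 1) \<le> z\<^sup>2" using z(2) by (simp add: power2_eq_square)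
    then have "freq k * (256 * (D + 1)) \<le> freq k * z\<^sup>2"
      using elim(2) by (intro mult_left_mono) auto
    then have 2: "(D + 1) * (4 * freq k) \<le> y\<^sup>2" unfolding y2 by (simp add: algebra_simps)
    have pos: "0 < 2 * (freq k + 1)" using elim(2) by simp
    have "y\<^sup>2 / (2 * (freq k + 1)) < D + 1"
      using elim(1,2) mult_left_mono[OF 1, of "1 / (2 * (freq k + 1))"] by simp
    then have 3: "y\<^sup>2 < (D + 1) * (2 * (freq k + 1))"
      unfolding pos_divide_less_eq[OF pos] .
    have "0 < (D + 1) * (2 * (freq k + 1))"
      using 3 zero_le_power2[of y] by linarith
    then have "0 < D + 1" using pos by (rule zero_less_mult_pos2)
    then have "(D + 1) * (2 * (freq k + 1)) \<le> (D + 1) * (4 * freq k)"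
      using elim(2) by (intro mult_left_mono) auto
    then show False using 2 3 by linarith
  qed
  then show False by simp
qed

text \<open>
  Any admissible continuation coincides with the sum of the series to the right of \<open>\<theta>\<close>, and the
  critical value exceeds \<open>\<theta>\<close>; so the failure of the mean value formula for the sum rules out all
  continuations.
\<close>

lemma abscissa_mean_coef: "abscissa_mean coef = ereal ((1 + 2 * \<theta>) / 4)"
  unfolding abscissa_mean_def
proof (rule antisym)
  define \<kappa>0 where "\<kappa>0 = (1 + 2 * \<theta>) / 4"
  have \<kappa>0: "\<theta> \<le> \<kappa>0" using \<theta>_lt by (simp add: \<kappa>0_def field_simps)
  have "is_analytic_continuation coef \<kappa>0 (dirichlet_sum coef)"
    using finite_order_dirichlet_sum[OF \<kappa>0] by (simp add: is_analytic_continuation_def finite_order_def)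
  then show "Inf {ereal \<kappa> |\<kappa>. \<exists>F. is_analytic_continuation coef \<kappa> F \<and> finite_order \<kappa> F \<and>
      (\<forall>\<sigma>>\<kappa>. mean_value_formula coef F \<sigma>)} \<le> ereal ((1 + 2 * \<theta>) / 4)"
    using finite_order_dirichlet_sum[OF \<kappa>0] mean_value_formula_dirichlet_sum
    unfolding \<kappa>0_def by (intro Inf_lower CollectI exI conjI refl) (auto intro: less_imp_le)
  show "ereal ((1 + 2 * \<theta>) / 4) \<le> Inf {ereal \<kappa> |\<kappa>. \<exists>F. is_analytic_continuation coef \<kappa> F \<and> finite_order \<kappa> F \<and>
      (\<forall>\<sigma>>\<kappa>. mean_value_formula coef F \<sigma>)}"
  proof (rule Inf_greatest)
    fix x assume "x \<in> {ereal \<kappa> |\<kappa>. \<exists>F. is_analytic_continuation coef \<kappa> F \<and> finite_order \<kappa> F \<and>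
      (\<forall>\<sigma>>\<kappa>. mean_value_formula coef F \<sigma>)}"
    then obtain \<kappa> F where x: "x = ereal \<kappa>" and F: "is_analytic_continuation coef \<kappa> F"
      and mv: "\<And>\<sigma>. \<kappa> < \<sigma> \<Longrightarrow> mean_value_formula coef F \<sigma>" by blast
    have "(1 + 2 * \<theta>) / 4 \<le> \<kappa>"
    proof (rule ccontr)
      assume "\<not> (1 + 2 * \<theta>) / 4 \<le> \<kappa>"
      moreover have "\<theta> < (1 + 2 * \<theta>) / 4" using \<theta>_lt by (simp add: field_simps)
      ultimately have "max \<kappa> \<theta> < (1 + 2 * \<theta>) / 4" by simp
      from dense[OF this] obtain \<sigma> where \<sigma>: "max \<kappa> \<theta> < \<sigma>" "\<sigma> < (1 + 2 * \<theta>) / 4" by blast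
      have "F (Complex \<sigma> t) = dirichlet_sum coef (Complex \<sigma> t)" for t
        using F \<sigma> sums_summable[OF dirichlet_term_sums[of "Complex \<sigma> t"]]
        by (simp add: is_analytic_continuation_def right_half_plane_def)
      then show False
        using mv[of \<sigma>] not_tendsto_mean[of \<sigma>] \<sigma> by (auto simp: mean_value_formula_def)
    qed
    then show "ereal ((1 + 2 * \<theta>) / 4) \<le> x" by (simp add: x)
  qed
qed

end

section \<open>The Lindelof order\<close>

lemma log_ext_div_le:
  assumes "0 < L" "0 \<le> x" "x \<le> exp z"
  shows "log_ext x / ereal L \<le> ereal (z / L)"
proof (cases "x = 0")
  case True
  then show ?thesis using assms by (simp add: log_ext_def divide_ereal_def)
next
  case False
  then have "ln x \<le> z" using False assms ln_le_cancel_iff[of x "exp z"] by simp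
  then show ?thesis using False assms by (simp add: log_ext_def divide_right_mono)
qed

lemma le_log_ext_div:
  assumes "0 < L" "exp z \<le> x"
  shows "ereal (z / L) \<le> log_ext x / ereal L"
proof -
  have "0 < x" using assms(2) exp_gt_zero[of z] by linarith
  then have "z \<le> ln x" using assms by (simp add: ln_ge_iff)
  then show ?thesis using \<open>0 < x\<close> assms by (simp add: log_ext_def divide_right_mono)
qed

context dyadic_dirichlet_series
begin

text \<open>
  A block contributes substantially only if \<open>freq j < 2 \<bar>t\<bar>\<close>, and then its trivial bound
  \<open>N powr (1 / 2 - \<sigma>)\<close> is a power of \<open>freq j\<close> whose exponent is the asserted order.
\<close>

lemma norm_dirichlet_sum_le_height:
  assumes \<sigma>: "\<theta> \<le> \<sigma>" "\<sigma> \<le> 1 / 2"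
  shows "cmod (dirichlet_sum coef (Complex \<sigma> t)) \<le> 192 * (1 + (2 * \<bar>t\<bar>) powr ((1 - 2 * \<sigma>) / (1 - 2 * \<theta>)))"
proof -
  define m where "m = (1 - 2 * \<sigma>) / (1 - 2 * \<theta>)"
  have m: "0 \<le> m" "(1 / 2 - \<theta>) * m = 1 / 2 - \<sigma>"
    using \<sigma> \<theta>_lt by (simp_all add: m_def field_simps)
  let ?s = "Complex \<sigma> t"
  have s: "\<theta> \<le> Re ?s" "- 1 \<le> Re ?s" using \<sigma> \<theta>_gt by auto
  have le: "cmod (block_sum j ?s) \<le> 96 * weight j * (1 + (2 * \<bar>t\<bar>) powr m)" for j
  proof (cases "2 * \<bar>t\<bar> \<le> freq j")
    case True
    have "real (block_start j) powr (\<theta> - \<sigma>) \<le> real (block_start j) powr 0"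
      using \<sigma> block_start_ge[of j] by (intro powr_mono) auto
    then have "real (block_start j) powr (\<theta> - \<sigma>) \<le> 1" by simp
    then have "real (block_start j) powr (\<theta> - \<sigma>) \<le> 1 + (2 * \<bar>t\<bar>) powr m"
      using powr_ge_zero[of "2 * \<bar>t\<bar>" m] by linarith
    then have "96 * weight j * real (block_start j) powr (\<theta> - \<sigma>) \<le> 96 * weight j * (1 + (2 * \<bar>t\<bar>) powr m)"
      by (intro mult_left_mono) auto
    moreover have "cmod (block_sum j ?s) \<le> 96 * weight j * real (block_start j) powr (\<theta> - \<sigma>)"
      unfolding block_sum_def block_def
      using norm_partial_block_le_small_height[of ?s j "block_start j" "2 * block_start j"] s True by simp
    ultimately show ?thesis by linarith
  next
    case False
    have "real (block_start j) powr (1 / 2 - \<sigma>) = freq j powr m"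
      unfolding freq_def powr_powr m ..
    also have "\<dots> \<le> (2 * \<bar>t\<bar>) powr m"
      using False freq_pos[of j] m by (intro powr_mono2) auto
    finally have "2 * weight j * real (block_start j) powr (1 / 2 - \<sigma>) \<le> 2 * weight j * (2 * \<bar>t\<bar>) powr m"
      by (intro mult_left_mono) auto
    also have "\<dots> \<le> 96 * weight j * (1 + (2 * \<bar>t\<bar>) powr m)"
      by (intro mult_mono) auto
    finally have "2 * weight j * real (block_start j) powr (1 / 2 - \<sigma>) \<le> 96 * weight j * (1 + (2 * \<bar>t\<bar>) powr m)" .
    moreover have "cmod (block_sum j ?s) \<le> 2 * weight j * real (block_start j) powr (1 / 2 - \<sigma>)"
      unfolding block_sum_def using norm_partial_block_le[of ?s "block j" j] s by simp
    ultimately show ?thesis by (rule order.trans[rotated])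
  qed
  have sums: "(\<lambda>j. 96 * weight j * (1 + (2 * \<bar>t\<bar>) powr m)) sums (96 * 2 * (1 + (2 * \<bar>t\<bar>) powr m))"
    by (intro sums_mult2 sums_mult weight_sums)
  have "cmod (\<Sum>j. block_sum j ?s) \<le> (\<Sum>j. 96 * weight j * (1 + (2 * \<bar>t\<bar>) powr m))"
    using le sums by (intro norm_suminf_le) (auto simp: sums_iff)
  then show ?thesis
    using sums by (simp add: dirichlet_sum_eq[OF s(1)] sums_iff m_def)
qed

lemma lindelof_order_le:
  assumes \<sigma>: "\<theta> < \<sigma>" "\<sigma> \<le> 1 / 2"
  shows "lindelof_order (dirichlet_sum coef) \<sigma> \<le> ereal ((1 - 2 * \<sigma>) / (1 - 2 * \<theta>))"
proof -
  define m where "m = (1 - 2 * \<sigma>) / (1 - 2 * \<theta>)"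
  have m: "0 \<le> m" using \<sigma> \<theta>_lt by (simp add: m_def)
  define C where "C = 192 * (1 + 2 powr m)"
  have C: "0 < C" using powr_ge_zero[of 2 m] by (simp add: C_def add_pos_nonneg)
  have ev: "\<forall>\<^sub>F t in at_infinity. 1 < \<bar>t :: real\<bar>"
    unfolding eventually_at_infinity by (rule exI[of _ 2]) auto
  have ln_lim: "filterlim (\<lambda>t::real. ln \<bar>t\<bar>) at_top at_infinity"
    using filterlim_compose[OF ln_at_top filterlim_norm_at_top[where 'a = real]] by simp
  have "lindelof_order (dirichlet_sum coef) \<sigma>
      \<le> Limsup at_infinity (\<lambda>t::real. ereal ((ln C + m * ln \<bar>t\<bar>) / ln \<bar>t\<bar>))"
    unfolding lindelof_order_def
  proof (rule Limsup_mono, use ev in eventually_elim)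
    case (elim t)
    have "cmod (dirichlet_sum coef (Complex \<sigma> t)) \<le> 192 * (1 + (2 * \<bar>t\<bar>) powr m)"
      unfolding m_def using \<sigma> by (intro norm_dirichlet_sum_le_height) auto
    also have "\<dots> \<le> 192 * (\<bar>t\<bar> powr m + 2 powr m * \<bar>t\<bar> powr m)"
      using elim m ge_one_powr_ge_zero[of "\<bar>t\<bar>" m] by (simp add: powr_mult)
    also have "\<dots> = C * \<bar>t\<bar> powr m" by (simp add: C_def algebra_simps)
    also have "\<dots> = exp (ln C + m * ln \<bar>t\<bar>)"
      using C elim by (simp add: exp_add powr_def)
    finally show ?case
      using elim by (intro log_ext_div_le) auto
  qed
  also have "\<dots> = ereal m"
  proof (rule lim_imp_Limsup)
    have "((\<lambda>t::real. ln C / ln \<bar>t\<bar> + m) \<longlongrightarrow> 0 + m) at_infinity"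
      by (intro tendsto_add tendsto_const tendsto_divide_0[OF tendsto_const]
          filterlim_at_top_imp_at_infinity[OF ln_lim])
    then have "((\<lambda>t::real. (ln C + m * ln \<bar>t\<bar>) / ln \<bar>t\<bar>) \<longlongrightarrow> m) at_infinity"
    proof (rule Lim_transform_eventually[THEN tendsto_eq_rhs])
      show "\<forall>\<^sub>F t in at_infinity. ln C / ln \<bar>t\<bar> + m = (ln C + m * ln \<bar>t :: real\<bar>) / ln \<bar>t\<bar>"
        using ev by eventually_elim (simp add: field_simps)
    qed simp
    then show "((\<lambda>t::real. ereal ((ln C + m * ln \<bar>t\<bar>) / ln \<bar>t\<bar>)) \<longlongrightarrow> ereal m) at_infinity"
      by (rule tendsto_ereal)
  qed (rule trivial_limit_at_infinity)
  finally show ?thesis by (simp add: m_def)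
qed

text \<open>
  The order is attained along the sequence of the frequencies.
\<close>

lemma lindelof_order_ge:
  assumes \<sigma>: "\<theta> < \<sigma>" "\<sigma> < 1 / 2"
  shows "ereal ((1 - 2 * \<sigma>) / (1 - 2 * \<theta>)) \<le> lindelof_order (dirichlet_sum coef) \<sigma>"
proof -
  define a where "a = (1 / 2 - \<theta>) * ln 2"
  define b where "b = (1 / 2 - \<sigma>) * ln 2"
  have a: "0 < a" using \<theta>_lt by (simp add: a_def)
  have ln_freq: "ln (freq k) = a * 2 ^ k" for k
    by (simp add: freq_def a_def ln_powr block_start_def ln_realpow)
  define z where "z k = b * 2 ^ k - ln 2 * real k - ln 8" for k
  have "(\<lambda>k. z k / (a * 2 ^ k)) \<longlonglongrightarrow> b / a"
  proof -
    have "(\<lambda>k. real k / 2 ^ k) \<longlonglongrightarrow> 0"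
      using powser_times_n_limit_0[of "1 / 2 :: real"] by (simp add: power_divide)
    moreover have "(\<lambda>k. (1 / 2 :: real) ^ k) \<longlonglongrightarrow> 0"
      by (intro LIMSEQ_power_zero) simp
    ultimately have "(\<lambda>k. b / a - ln 2 / a * (real k / 2 ^ k) - ln 8 / a * (1 / 2) ^ k)
        \<longlonglongrightarrow> b / a - ln 2 / a * 0 - ln 8 / a * 0"
      by (intro tendsto_diff tendsto_mult tendsto_const)
    moreover have "b / a - ln 2 / a * (real k / 2 ^ k) - ln 8 / a * (1 / 2) ^ k = z k / (a * 2 ^ k)" for k
      using a by (simp add: z_def field_simps power_divide)
    ultimately show ?thesis by simp
  qed
  then have lim: "(\<lambda>k. ereal (z k / (a * 2 ^ k))) \<longlonglongrightarrow> ereal (b / a)"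
    by (rule tendsto_ereal)
  have ba: "b / a = (1 - 2 * \<sigma>) / (1 - 2 * \<theta>)"
    using \<theta>_lt by (simp add: a_def b_def field_simps)
  let ?L = "\<lambda>t. log_ext (cmod (dirichlet_sum coef (Complex \<sigma> t))) / ereal (ln \<bar>t\<bar>)"
  have near: "\<forall>\<^sub>F k in sequentially. ereal (z k / (a * 2 ^ k)) \<le> ?L (freq k)"
    using block_dominates_near_freq[OF \<sigma>]
  proof eventually_elim
    case (elim k)
    have "exp (z k) = weight k * real (block_start k) powr (1 / 2 - \<sigma>) / 8"
    proof -
      have "exp (ln 2 * real k) = (2::real) ^ k"
        by (metis exp_ln exp_of_nat2_mult mult.commute zero_less_numeral)
      moreover have "exp (b * 2 ^ k) = real (block_start k) powr (1 / 2 - \<sigma>)"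
        by (simp add: powr_def block_start_def ln_realpow b_def mult_ac)
      ultimately show ?thesis by (simp add: z_def exp_diff weight_def power_divide)
    qed
    also have "\<dots> \<le> cmod (dirichlet_sum coef (Complex \<sigma> (freq k)))"
      using elim[rule_format, of "freq k"] by simp
    finally show ?case
      using le_log_ext_div[of "ln (freq k)" "z k"] a freq_pos[of k] by (simp add: ln_freq)
  qed
  have freq_inf: "filterlim freq at_infinity sequentially"
    by (rule filterlim_at_top_imp_at_infinity[OF freq_at_top])
  have "ereal (b / a) \<le> Limsup at_infinity ?L"
  proof (rule ccontr)
    assume "\<not> ereal (b / a) \<le> Limsup at_infinity ?L"
    then have "Limsup at_infinity ?L < ereal (b / a)" by simp
    from dense[OF this] obtain y where y: "Limsup at_infinity ?L < y" "y < ereal (b / a)" by blast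
    from filterlim_iff[THEN iffD1, OF freq_inf, rule_format, OF Limsup_lessD[OF y(1)]]
    have "\<forall>\<^sub>F k in sequentially. ?L (freq k) < y" .
    moreover have "\<forall>\<^sub>F k in sequentially. y < ereal (z k / (a * 2 ^ k))"
      by (rule order_tendstoD(1)[OF lim y(2)])
    ultimately have "\<forall>\<^sub>F k in sequentially. False"
      using near by eventually_elim (meson less_le_trans less_trans less_irrefl)
    then show False by simp
  qed
  then show ?thesis unfolding lindelof_order_def ba .
qed

text \<open>
  On this line the earlier blocks are as large as the current one and could cancel it. Instead,
  an order below zero would force decay to zero, while the mean square converges to a positive number.
\<close>

lemma lindelof_order_half_ge: "0 \<le> lindelof_order (dirichlet_sum coef) (1 / 2)"
proof (rule ccontr)
  let ?f = "\<lambda>t. dirichlet_sum coef (Complex (1 / 2) t)"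
  assume "\<not> 0 \<le> lindelof_order (dirichlet_sum coef) (1 / 2)"
  then have "lindelof_order (dirichlet_sum coef) (1 / 2) < 0" by simp
  from ereal_dense2[OF this] obtain r
    where r: "lindelof_order (dirichlet_sum coef) (1 / 2) < ereal r" "ereal r < 0" by blast
  then have r0: "r < 0" by simp
  have ev: "\<forall>\<^sub>F t in at_infinity. 1 < \<bar>t :: real\<bar>"
    unfolding eventually_at_infinity by (rule exI[of _ 2]) auto
  have "(?f \<longlongrightarrow> 0) at_infinity"
  proof (rule Lim_null_comparison)
    show "\<forall>\<^sub>F t in at_infinity. cmod (?f t) \<le> \<bar>t\<bar> powr r"
      using Limsup_lessD[OF r(1)[unfolded lindelof_order_def]] ev
    proof eventually_elim
      case (elim t)
      show ?case
      proof (rule ccontr)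
        assume "\<not> cmod (?f t) \<le> \<bar>t\<bar> powr r"
        then have "exp (r * ln \<bar>t\<bar>) \<le> cmod (?f t)" 
          using elim(2) by (cases "t = 0") (auto simp: powr_def)
        from le_log_ext_div[OF _ this, of "ln \<bar>t\<bar>"] elim show False
          by (simp add: not_less[symmetric])
      qed
    qed
    show "((\<lambda>t::real. \<bar>t\<bar> powr r) \<longlongrightarrow> 0) at_infinity"
      using tendsto_neg_powr[OF r0 filterlim_norm_at_top[where 'a = real]] by simp
  qed
  then have "((\<lambda>T. rms T ?f) \<longlongrightarrow> 0) at_top"
    using \<theta>_lt by (intro tendsto_rms_zero continuous_on_vertical_line)
  moreover have "((\<lambda>T. rms T ?f) \<longlongrightarrow>
      sqrt (\<Sum>k. (cmod (coef (Suc k)))\<^sup>2 * real (Suc k) powr (- 2 * (1 / 2)))) at_top"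
    using \<theta>_lt by (intro tendsto_rms_dirichlet_sum) (simp add: field_simps)
  ultimately have "sqrt (\<Sum>k. (cmod (coef (Suc k)))\<^sup>2 * real (Suc k) powr (- 2 * (1 / 2))) = 0"
    using tendsto_unique[OF trivial_limit_at_top_linorder] by blast
  moreover have "0 < (\<Sum>k. (cmod (coef (Suc k)))\<^sup>2 * real (Suc k) powr (- 2 * (1 / 2)))"
  proof (rule suminf_pos2[of _ 1])
    show "summable (\<lambda>k. (cmod (coef (Suc k)))\<^sup>2 * real (Suc k) powr (- 2 * (1 / 2)))"
      by (intro summable_mean_series) auto
    \<comment> \<open>The first block is \<open>{2, 3}\<close>, so the coefficient of \<open>n = 2\<close> is nonzero.\<close>
    have "Suc 1 \<in> block 0" by (simp add: block_def block_start_def)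
    then show "0 < (cmod (coef (Suc 1)))\<^sup>2 * real (Suc 1) powr (- 2 * (1 / 2))"
      by (simp add: norm_coef_block weight_def)
  qed auto
  ultimately show False by simp
qed

lemma lindelof_order_coef:
  assumes "\<theta> < \<sigma>" "\<sigma> \<le> 1 / 2"
  shows "lindelof_order (dirichlet_sum coef) \<sigma> = ereal ((1 - 2 * \<sigma>) / (1 - 2 * \<theta>))"
proof (rule antisym[OF lindelof_order_le[OF assms]])
  show "ereal ((1 - 2 * \<sigma>) / (1 - 2 * \<theta>)) \<le> lindelof_order (dirichlet_sum coef) \<sigma>"
  proof (cases "\<sigma> = 1 / 2")
    case True
    then have "ereal ((1 - 2 * \<sigma>) / (1 - 2 * \<theta>)) = 0" by simp
    then show ?thesis using lindelof_order_half_ge True by metis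
  next
    case False
    then show ?thesis using lindelof_order_ge assms by simp
  qed
qed

end

section \<open>The counterexample\<close>

theorem mainTheorem6:
  shows "(\<forall>\<theta>::real. - (1/2) < \<theta> \<and> \<theta> < 1/2 \<longrightarrow>
           (\<exists>g \<in> hardy_H2.
              abscissa_conv g = ereal \<theta> \<and>
              abscissa_abs_conv g = ereal (1/2) \<and>
              finite_order \<theta> (dirichlet_sum g) \<and>
              (\<forall>\<sigma>. \<theta> < \<sigma> \<and> \<sigma> \<le> 1/2 \<longrightarrow>
                 lindelof_order (dirichlet_sum g) \<sigma> = ereal ((1 - 2 * \<sigma>) / (1 - 2 * \<theta>))) \<and>
              abscissa_mean g = ereal ((1 + 2 * \<theta>) / 4)))
         \<and> \<not> (\<forall>f \<in> hardy_H2. abscissa_conv f \<le> 0 \<longrightarrow> abscissa_mean f \<le> 0)"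
proof (intro conjI allI impI)
  fix \<theta> :: real
  assume "- (1/2) < \<theta> \<and> \<theta> < 1/2"
  then interpret dyadic_dirichlet_series \<theta> by unfold_locales auto
  show "\<exists>g \<in> hardy_H2.
              abscissa_conv g = ereal \<theta> \<and>
              abscissa_abs_conv g = ereal (1/2) \<and>
              finite_order \<theta> (dirichlet_sum g) \<and>
              (\<forall>\<sigma>. \<theta> < \<sigma> \<and> \<sigma> \<le> 1/2 \<longrightarrow>
                 lindelof_order (dirichlet_sum g) \<sigma> = ereal ((1 - 2 * \<sigma>) / (1 - 2 * \<theta>))) \<and>
              abscissa_mean g = ereal ((1 + 2 * \<theta>) / 4)"
    using coef_in_H2 abscissa_conv_coef abscissa_abs_conv_coef finite_order_dirichlet_sum[of \<theta>]
      lindelof_order_coef abscissa_mean_coef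
    by (intro bexI[of _ coef]) auto
next
  interpret dyadic_dirichlet_series 0 by unfold_locales auto
  show "\<not> (\<forall>f \<in> hardy_H2. abscissa_conv f \<le> 0 \<longrightarrow> abscissa_mean f \<le> 0)"
    using coef_in_H2 abscissa_conv_coef abscissa_mean_coef
    by (auto simp: zero_ereal_def intro!: bexI[of _ coef])
qed

end
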